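(* Let $0<|q|<1$ and let $n=1,2,3,\dots$. Then $$\vartheta_3(0,-q)^{4n^2}=1+\sum_{p=1}^{n}(-1)^p2^{2n^2+n}\prod_{r=1}^{2n-1}(r!)^{-1}\sum_{\substack{\emptyset\subset S\subseteq I_n\\ \|S\|=p}}\det(M_{n,S}),$$ where $M_{n,S}$ is the $n\times n$ matrix whose $i$-th row is $$U_{2i-1},\,U_{2(i+1)-1},\,\dots,\,U_{2(i+n-1)-1}\quad\text{if } i\in S,\qquad\text{and}\qquad c_i,\,c_{i+1},\,\dots,\,c_{i+n-1}\quad\text{if } i\notin S,$$ with, for $i=1,2,3,\dots$, $$U_{2i-1}\equiv U_{2i-1}(q):=\sum_{r=1}^{\infty}(-1)^{r-1}\frac{r^{2i-1}q^r}{1+q^r},\qquad c_i:=(-1)^{i-1}\frac{2^{2i}-1}{4i}\,|B_{2i}|.$$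
   Context: $\vartheta_3(0,q):=\sum_{j=-\infty}^{\infty}q^{j^2}$, so $\vartheta_3(0,-q)=\sum_{j=-\infty}^{\infty}(-1)^{j}q^{j^2}$. $I_n:=\{1,2,\dots,n\}$, and $\|S\|$ is the cardinality of $S$; the inner sum is over all subsets $S$ of $I_n$ with exactly $p$ elements. The Bernoulli numbers $B_n$ are defined by $\frac{t}{e^t-1}=\sum_{n=0}^{\infty}B_n\frac{t^n}{n!}$, $|t|<2\pi$. *)

theory Defs
  imports
    "HOL-Complex_Analysis.Complex_Analysis"
    "Jordan_Normal_Form.Determinant"
begin

text \<open>
  The Bernoulli numbers, read off from the exponential generating function
  \<open>t / (exp t - 1)\<close> (so \<open>B\<^sub>1 = - 1/2\<close>). The quotient is a formal one;
  \<open>bernoulli_sums\<close> below is the corresponding analytic identity.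
\<close>

definition bernoulli :: "nat \<Rightarrow> real" where
  "bernoulli n = fact n * fps_nth (fps_X / (fps_exp 1 - 1)) n"

lemma bernoulli_sums:
  fixes t :: complex
  assumes "t \<noteq> 0" and "norm t < 2 * pi"
  shows "(\<lambda>n. of_real (bernoulli n) * t ^ n / fact n) sums (t / (exp t - 1))"
proof -
  define g :: "complex fps" where "g = fps_exp 1 - 1"
  define gr :: "real fps" where "gr = fps_exp 1 - 1"
  have sub: "subdegree g = 1" "subdegree gr = 1"
    by (auto intro!: subdegreeI simp: g_def gr_def)
  have nz: "g \<noteq> 0" "gr \<noteq> 0"
    using sub by auto
  define F :: "complex fps" where "F = fps_X / g"
  have dvd: "g dvd fps_X" "gr dvd fps_X"
    using nz sub by (auto simp: fps_dvd_iff)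
  have real_mult: "fps_X / gr * gr = fps_X"
    using dvd by simp
  define R where "R = Abs_fps (\<lambda>n. complex_of_real (fps_nth (fps_X / gr) n))"
  have "R * g = fps_X"
  proof (rule fps_ext)
    fix n
    have "fps_nth (R * g) n = of_real (fps_nth (fps_X / gr * gr) n)"
      by (auto simp: fps_mult_nth R_def g_def gr_def intro!: sum.cong)
    thus "fps_nth (R * g) n = fps_nth fps_X n"
      unfolding real_mult by simp
  qed
  hence F_eq: "F = R"
    unfolding F_def using nz(1) by (metis nonzero_mult_div_cancel_right)
  have conv: "fps_conv_radius g = \<infinity>"
    using fps_conv_radius_diff[of "fps_exp (1::complex)" 1] by (simp add: g_def)
  have ev: "eval_fps g z = exp z - 1" for z
    unfolding g_def by (subst eval_fps_diff) auto
  have g_nz: "eval_fps g z \<noteq> 0" if "z \<in> eball 0 (ereal (2 * pi))" "z \<noteq> 0" for z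
  proof
    assume "eval_fps g z = 0"
    hence "exp z = 1" by (simp add: ev)
    then obtain k :: int where k: "Re z = 0" "Im z = of_int (2 * k) * pi"
      by (auto simp: exp_eq_1)
    have "norm z = 2 * pi * \<bar>of_int k\<bar>"
      using k by (simp add: cmod_def abs_mult)
    moreover have "k \<noteq> 0" using k that(2) by (auto simp: complex_eq_iff)
    hence "\<bar>real_of_int k\<bar> \<ge> 1" by linarith
    ultimately have "norm z \<ge> 2 * pi" by simp
    thus False using that(1) by (simp add: in_eball_iff)
  qed
  have pos: "ereal (2 * pi) > 0"
    by simp
  have Min_eq: "Min {ereal (2 * pi), fps_conv_radius (fps_X :: complex fps), fps_conv_radius g} =
      ereal (2 * pi)"
    by (simp add: conv)
  have le: "subdegree g \<le> subdegree (fps_X :: complex fps)"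
    using sub by simp
  have pos': "fps_conv_radius (fps_X :: complex fps) > 0" "fps_conv_radius g > 0"
    by (simp_all add: conv)
  have "Min {ereal (2 * pi), fps_conv_radius (fps_X :: complex fps), fps_conv_radius g} \<le>
      fps_conv_radius F"
    unfolding F_def by (rule fps_conv_radius_divide[OF le pos' pos]) (rule g_nz)
  hence radius: "fps_conv_radius F \<ge> ereal (2 * pi)"
    unfolding Min_eq .
  have norm_t: "ereal (norm t) < ereal (2 * pi)"
    using assms(2) by simp
  have "eval_fps (fps_X / g) t = (if t = 0 then fps_nth fps_X (subdegree g) / fps_nth g (subdegree g)
      else eval_fps fps_X t / eval_fps g t)"
    by (rule eval_fps_divide[OF le pos' pos _ _ refl])
       (erule (1) g_nz, unfold Min_eq, rule norm_t)
  hence eval: "eval_fps F t = t / (exp t - 1)"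
    using assms(1) by (simp add: F_def ev)
  have "ereal (norm t) < fps_conv_radius F"
    using norm_t radius by (rule less_le_trans)
  hence "(\<lambda>n. fps_nth F n * t ^ n) sums eval_fps F t"
    by (rule sums_eval_fps)
  thus ?thesis
    unfolding eval unfolding F_eq by (simp add: R_def bernoulli_def gr_def)
qed

text \<open>
  For \<open>norm q < 1\<close> the two series below converge absolutely, so the unordered sums
  agree with the usual ones. Only odd \<open>k\<close> occur in \<open>lambertU k q\<close>.
\<close>

definition theta3_0 :: "complex \<Rightarrow> complex" where
  "theta3_0 q = (\<Sum>\<^sub>\<infinity>j\<in>(UNIV :: int set). q powi (j ^ 2))"

definition lambertU :: "nat \<Rightarrow> complex \<Rightarrow> complex" where
  "lambertU k q = (\<Sum>\<^sub>\<infinity>r\<in>{1..}. (-1) ^ (r - 1) * (of_nat r ^ k * q ^ r / (1 + q ^ r)))"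

definition bern_c :: "nat \<Rightarrow> real" where
  "bern_c i = (-1) ^ (i - 1) * ((2 ^ (2 * i) - 1) / (4 * real i)) * \<bar>bernoulli (2 * i)\<bar>"

text \<open>
  Matrices have 0-based positions here, whereas \<open>S\<close> is a set of 1-based row numbers:
  position \<open>(a, b)\<close> is row \<open>i = a + 1\<close>, column \<open>j = b + 1\<close>, whose entry
  has index \<open>i + j - 1 = i + b\<close>.
\<close>

definition mat_M :: "nat \<Rightarrow> nat set \<Rightarrow> complex \<Rightarrow> complex mat" where
  "mat_M n S q = mat n n (\<lambda>(a, b).
     let i = a + 1 in
     if i \<in> S then lambertU (2 * (i + b) - 1) q else of_real (bern_c (i + b)))"

end

theory Submission
  imports Defs
begin

text \<open>
  Summing over \<open>S\<close> expands a determinant row by row, so the right-hand side is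
  \<open>1 - K * det (c) + K * det (c - U)\<close> with Hankel matrices in \<open>c\<close> and \<open>c - U\<close>, where \<open>K\<close> is the
  power of 2 times the inverse factorials. Both Hankel
  matrices consist (up to a factor 4) of the odd Taylor coefficients at 0 of an odd function \<open>f\<close> with
  \<open>f'' = \<beta> f + f\<^sup>3 / 2\<close>: \<open>tanh (w / 2)\<close> for \<open>c\<close>, and an elliptic function given by a Lambert series
  in \<open>exp w\<close> for \<open>c - U\<close>. The differential equation makes every even derivative of \<open>f\<close> a polynomial
  in \<open>f\<close> with known leading coefficient, which factors the Hankel matrix into triangular ones; its
  determinant depends only on \<open>f' 0\<close>. For \<open>tanh (w / 2)\<close> this gives \<open>K * det (c) = 1\<close>; for the elliptic
  function, \<open>f' 0 = theta3_0 (- q) ^ 4 / 2\<close> is Jacobi's four squares theorem.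
\<close>

no_notation vec_index (infixl "$" 100)
no_notation vec_nth (infixl "$" 90)

subsection \<open>Hankel determinants\<close>

text \<open>The exponent \<open>4 * n\<^sup>2\<close> is four times 1 + 3 + ... + (2 n - 1): the
  diagonal of the upper triangular factor contributes \<open>f' 0\<close> to the power
  \<open>2 * a + 1\<close> for each \<open>a < n\<close>. The coefficient \<beta> enters the lower
  triangular factor only below its diagonal, so it never has to be known; for the elliptic function
  the existence of some \<beta> is enough. Its differential equation is obtained without quotients
  of theta functions: with \<open>z = exp w\<close> the function lives on an annulus and changes
  sign under z -> q z, both sides of the equation do so too, and a holomorphic function on the
  annulus with that sign change is zero. Identifying \<open>f' 0\<close> with a power of the theta
  value is reduced to two terminating identities for finite products of 1 - q^k and 1 + q^k, proved
  by induction on the length; as the length tends to infinity they give the product for theta and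
  the series for its fourth power.\<close>

lemma fps_first_integral:
  fixes \<phi> :: "'a::field_char_0 fps"
  assumes zero: "\<phi> $ 0 = 0"
    and ode: "fps_deriv (fps_deriv \<phi>) = fps_const \<beta> * \<phi> + fps_const (1/2) * \<phi> ^ 3"
  shows "fps_deriv \<phi> ^ 2 = fps_const ((\<phi> $ 1)\<^sup>2) + fps_const \<beta> * \<phi> ^ 2 + fps_const (1/4) * \<phi> ^ 4"
proof -
  \<comment> \<open>Conservation of energy: \<open>r\<close> is an antiderivative of 2 \<phi>'
    \<phi>'', with the equation inserted for \<phi>''. The integration constant is then fixed by
    \<phi>(0) = 0.\<close>
  define r where "r = fps_const \<beta> * (\<phi> * \<phi>) + fps_const (1/4) * (\<phi> * \<phi> * \<phi> * \<phi>)"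
  define b h d where "b = fps_const \<beta>" and "h = fps_const (1/2 :: 'a)" and "d = fps_const (1/4 :: 'a)"
  have hd: "h = 2 * d"
    by (simp add: h_def d_def numeral_fps_const)
  have "fps_deriv (fps_deriv \<phi> * fps_deriv \<phi>) = fps_deriv r"
    unfolding r_def fps_deriv_add fps_deriv_mult fps_deriv_const ode
    unfolding b_def[symmetric] h_def[symmetric] d_def[symmetric] hd
    by (simp add: algebra_simps power3_eq_cube)
  hence "fps_deriv \<phi> * fps_deriv \<phi> = fps_const ((fps_deriv \<phi> * fps_deriv \<phi>) $ 0 - r $ 0) + r"
    by (simp only: fps_deriv_eq_iff)
  thus ?thesis
    using zero by (simp add: r_def power2_eq_square power4_eq_xxxx algebra_simps)
qed

text \<open>In (\<phi>^N)'' = N (N - 1) \<phi>^(N-2) (\<phi>')^2 + N \<phi>^(N-1) \<phi>'' the first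
  integral replaces (\<phi>')^2 and the equation replaces \<phi>'', so the span of the odd powers is
  closed under second derivatives. At \<open>m = 0\<close> the truncated exponent
  \<open>2 * m - 1\<close> is harmless, as its coefficient is 0.\<close>

lemma fps_deriv2_odd_power:
  fixes \<phi> :: "'a::field_char_0 fps"
  assumes zero: "\<phi> $ 0 = 0"
    and ode: "fps_deriv (fps_deriv \<phi>) = fps_const \<beta> * \<phi> + fps_const (1/2) * \<phi> ^ 3"
  shows "fps_deriv (fps_deriv (\<phi> ^ (2 * m + 1))) =
    fps_const (of_nat ((2 * m + 1) * (2 * m)) * (\<phi> $ 1)\<^sup>2) * \<phi> ^ (2 * m - 1) +
    fps_const (of_nat ((2 * m + 1)\<^sup>2) * \<beta>) * \<phi> ^ (2 * m + 1) +
    fps_const (of_nat ((2 * m + 1) * (2 * m + 2)) / 4) * \<phi> ^ (2 * m + 3)"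
proof (cases m)
  case 0
  thus ?thesis using ode by simp
next
  case (Suc k)
  define A b h d where "A = fps_const ((\<phi> $ 1)\<^sup>2)" and "b = fps_const \<beta>"
    and "h = fps_const (1/2 :: 'a)" and "d = fps_const (1/4 :: 'a)"
  have hd: "h = 2 * d"
    by (simp add: h_def d_def numeral_fps_const)
  define n where "n = 2 * k"
  define N where "N = (of_nat n :: 'a fps)"
  have pw: "fps_deriv (\<phi> ^ (j + 1)) = (of_nat j + 1) * \<phi> ^ j * fps_deriv \<phi>" for j
    using fps_deriv_power[of \<phi> "j + 1"]
    by (simp add: fps_of_nat[symmetric] algebra_simps del: power_Suc fps_const_add flip: fps_const_add)
  have exps: "2 * m + 1 = (n + 2) + 1" "2 * m - 1 = n + 1" "n + 2 = (n + 1) + 1"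
    "2 * m + 3 = n + 5" "2 * m + 2 = n + 4" "2 * m = n + 2"
    by (simp_all add: Suc n_def)
  have exps_of: "n + 1 = 2 * m - 1" "n + 3 = 2 * m + 1" "n + 5 = 2 * m + 3"
    by (simp_all add: Suc n_def)
  have "fps_deriv (fps_deriv (\<phi> ^ (2 * m + 1))) =
      (N + 3) * ((N + 2) * \<phi> ^ (n + 1) * fps_deriv \<phi> ^ 2 + \<phi> ^ (n + 2) * fps_deriv (fps_deriv \<phi>))"
  proof -
    define P where "P = \<phi> ^ (n + 2)"
    have P': "fps_deriv P = (N + 2) * \<phi> ^ (n + 1) * fps_deriv \<phi>"
      using pw[of "n + 1"] by (simp add: P_def N_def exps(3) del: power_Suc)
    have N': "fps_deriv N = 0"
      by (simp add: N_def fps_of_nat[symmetric])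
    have "fps_deriv (\<phi> ^ (2 * m + 1)) = (N + 3) * P * fps_deriv \<phi>"
      unfolding exps(1) pw by (simp add: N_def P_def)
    thus ?thesis
      unfolding P_def[symmetric] by (simp add: fps_deriv_mult P' N' power2_eq_square algebra_simps)
  qed
  also have "\<dots> = (N + 3) * ((N + 2) * \<phi> ^ (n + 1) * (A + b * \<phi> ^ 2 + d * \<phi> ^ 4) +
      \<phi> ^ (n + 2) * (b * \<phi> + h * \<phi> ^ 3))"
    unfolding fps_first_integral[OF assms] ode by (simp add: A_def b_def h_def d_def)
  also have "\<dots> = (N + 3) * (N + 2) * A * \<phi> ^ (n + 1) + (N + 3) ^ 2 * b * \<phi> ^ (n + 3)
      + (N + 3) * (N + 4) * d * \<phi> ^ (n + 5)"
    unfolding hd by (simp add: algebra_simps power2_eq_square power_add power3_eq_cube power4_eq_xxxx numeral_eq_Suc)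
  also have "(N + 3) * (N + 2) * A = fps_const (of_nat ((2 * m + 1) * (2 * m)) * (\<phi> $ 1)\<^sup>2)"
    by (simp add: exps(6) N_def A_def fps_of_nat[symmetric] numeral_fps_const del: of_nat_add of_nat_mult)
       (simp add: algebra_simps)
  also have "(N + 3) ^ 2 * b = fps_const (of_nat ((2 * m + 1)\<^sup>2) * \<beta>)"
    unfolding exps(6)
    by (simp add: N_def b_def fps_of_nat[symmetric] numeral_fps_const power2_eq_square algebra_simps)
  also have "(N + 3) * (N + 4) * d = fps_const (of_nat ((2 * m + 1) * (2 * m + 2)) / 4)"
    unfolding exps(6) by (simp add: N_def d_def fps_of_nat[symmetric] numeral_fps_const algebra_simps)
  finally show ?thesis
    unfolding exps_of .
qed

text \<open>The coefficient of \<phi>^(2m+1) in the derivative of order 2a, with \<alpha> for the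
  square of \<phi>'(0). The three summands collect what \<phi>^(2m+3), \<phi>^(2m+1) and
  \<phi>^(2m-1) contribute under one more double differentiation.\<close>

primrec odd_power_coeff :: "'a::field_char_0 \<Rightarrow> 'a \<Rightarrow> nat \<Rightarrow> nat \<Rightarrow> 'a" where
  "odd_power_coeff \<alpha> \<beta> 0 m = (if m = 0 then 1 else 0)"
| "odd_power_coeff \<alpha> \<beta> (Suc a) m =
     odd_power_coeff \<alpha> \<beta> a (Suc m) * (of_nat ((2 * Suc m + 1) * (2 * Suc m)) * \<alpha>) +
     odd_power_coeff \<alpha> \<beta> a m * (of_nat ((2 * m + 1)\<^sup>2) * \<beta>) +
     (case m of 0 \<Rightarrow> 0 | Suc k \<Rightarrow> odd_power_coeff \<alpha> \<beta> a k * (of_nat ((2 * k + 1) * (2 * k + 2)) / 4))"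

lemma odd_power_coeff_eq_0: "a < m \<Longrightarrow> odd_power_coeff \<alpha> \<beta> a m = 0"
  by (induction a arbitrary: m) (auto split: nat.splits)

text \<open>Only the last summand of the recursion reaches the diagonal, so the value is the product
  of (2 k + 1)(2 k + 2) / 4 over k < a, free of \<alpha> and \<beta>.\<close>

lemma odd_power_coeff_diag: "odd_power_coeff \<alpha> \<beta> a a = fact (2 * a) / 4 ^ a"
  by (induction a) (auto simp: odd_power_coeff_eq_0 field_simps)

lemma fps_deriv_even_expand:
  fixes \<phi> :: "'a::field_char_0 fps"
  assumes zero: "\<phi> $ 0 = 0"
    and ode: "fps_deriv (fps_deriv \<phi>) = fps_const \<beta> * \<phi> + fps_const (1/2) * \<phi> ^ 3"
  shows "(fps_deriv ^^ (2 * a)) \<phi> =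
    (\<Sum>m\<le>a. fps_const (odd_power_coeff ((\<phi> $ 1)\<^sup>2) \<beta> a m) * \<phi> ^ (2 * m + 1))"
proof (induction a)
  case 0
  show ?case by simp
next
  case (Suc a)
  define c where "c = odd_power_coeff ((\<phi> $ 1)\<^sup>2) \<beta> a"
  define u v w where "u = (\<lambda>m. of_nat ((2 * m + 1) * (2 * m)) * (\<phi> $ 1)\<^sup>2)"
    and "v = (\<lambda>m. of_nat ((2 * m + 1)\<^sup>2) * \<beta>)"
    and "w = (\<lambda>m. of_nat ((2 * m + 1) * (2 * m + 2)) / (4 :: 'a))"
  have c0: "c m = 0" if "m > a" for m
    using that by (simp add: c_def odd_power_coeff_eq_0)
  have c_Suc: "odd_power_coeff ((\<phi> $ 1)\<^sup>2) \<beta> (Suc a) m =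
      c (Suc m) * u (Suc m) + c m * v m + (case m of 0 \<Rightarrow> 0 | Suc k \<Rightarrow> c k * w k)" for m
    by (simp only: odd_power_coeff.simps c_def u_def v_def w_def)
  have deriv2: "fps_deriv (fps_deriv (\<phi> ^ (2 * m + 1))) = fps_const (u m) * \<phi> ^ (2 * m - 1) +
      fps_const (v m) * \<phi> ^ (2 * m + 1) + fps_const (w m) * \<phi> ^ (2 * m + 3)" for m
    unfolding u_def v_def w_def by (rule fps_deriv2_odd_power[OF assms])
  have "(fps_deriv ^^ (2 * Suc a)) \<phi> = fps_deriv (fps_deriv ((fps_deriv ^^ (2 * a)) \<phi>))"
    by simp
  also have "\<dots> = (\<Sum>m\<le>a. fps_const (c m) * fps_deriv (fps_deriv (\<phi> ^ (2 * m + 1))))"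
    unfolding Suc c_def[symmetric] by (simp add: fps_deriv_sum del: power_Suc)
  also have "\<dots> = (\<Sum>m\<le>a. fps_const (c m * u m) * \<phi> ^ (2 * m - 1)) +
      (\<Sum>m\<le>a. fps_const (c m * v m) * \<phi> ^ (2 * m + 1)) +
      (\<Sum>m\<le>a. fps_const (c m * w m) * \<phi> ^ (2 * m + 3))"
    unfolding deriv2
    by (simp add: sum.distrib[symmetric] ring_distribs mult.assoc[symmetric])
  \<comment> \<open>Vanishing terms are appended so that after the index shift, which drops the
    \<open>m = 0\<close> term because \<open>u 0 = 0\<close>, all three sums run up to
    \<open>Suc a\<close>.\<close>
  also have "(\<Sum>m\<le>a. fps_const (c m * u m) * \<phi> ^ (2 * m - 1)) =
      (\<Sum>m\<le>Suc (Suc a). fps_const (c m * u m) * \<phi> ^ (2 * m - 1))"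
    by (rule sum.mono_neutral_left) (auto simp: c0)
  also have "\<dots> = (\<Sum>m\<le>Suc a. fps_const (c (Suc m) * u (Suc m)) * \<phi> ^ (2 * m + 1))"
    by (subst sum.atMost_Suc_shift) (simp add: u_def)
  also have "(\<Sum>m\<le>a. fps_const (c m * v m) * \<phi> ^ (2 * m + 1)) =
      (\<Sum>m\<le>Suc a. fps_const (c m * v m) * \<phi> ^ (2 * m + 1))"
    by (simp add: c0)
  also have "(\<Sum>m\<le>a. fps_const (c m * w m) * \<phi> ^ (2 * m + 3)) =
      (\<Sum>m\<le>Suc a. fps_const (case m of 0 \<Rightarrow> 0 | Suc k \<Rightarrow> c k * w k) * \<phi> ^ (2 * m + 1))"
    by (subst sum.atMost_Suc_shift) (simp add: numeral_3_eq_3)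
  finally show ?case
    unfolding c_Suc by (simp only: sum.distrib fps_const_add[symmetric] ring_distribs)
qed

lemma fps_power_nth_below:
  fixes \<phi> :: "'a::comm_ring_1 fps"
  assumes "\<phi> $ 0 = 0"
  shows "k < n \<Longrightarrow> (\<phi> ^ n) $ k = 0" and "(\<phi> ^ n) $ n = (\<phi> $ 1) ^ n"
proof -
  have eq: "\<phi> = fps_X * fps_shift 1 \<phi>"
    using assms by (intro fps_ext) auto
  have pw: "\<phi> ^ n = fps_X ^ n * fps_shift 1 \<phi> ^ n"
    by (subst eq) (rule power_mult_distrib)
  show "k < n \<Longrightarrow> (\<phi> ^ n) $ k = 0" "(\<phi> ^ n) $ n = (\<phi> $ 1) ^ n"
    by (simp_all add: pw fps_X_power_mult_nth fps_power_zeroth)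
qed

text \<open>
  Taylor coefficients are derivatives at 0. Taking \<open>2 a\<close> derivatives of \<open>\<phi>\<close> first and expanding in odd powers
  of \<open>\<phi>\<close> is the lower triangular factor \<open>L\<close>; the remaining \<open>2 b + 1\<close> derivatives of these powers form
  the upper triangular factor \<open>V\<close>.
\<close>

lemma hankel_det_of_ode:
  fixes \<phi> :: "'a::field_char_0 fps"
  assumes zero: "\<phi> $ 0 = 0"
    and ode: "fps_deriv (fps_deriv \<phi>) = fps_const \<beta> * \<phi> + fps_const (1/2) * \<phi> ^ 3"
  shows "Determinant.det (mat n n (\<lambda>(a, b). fact (2 * (a + b) + 1) * \<phi> $ (2 * (a + b) + 1))) =
    (\<Prod>a<n. fact (2 * a) * fact (2 * a + 1) * (\<phi> $ 1) ^ (2 * a + 1) / 4 ^ a)"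
proof -
  define c where "c = odd_power_coeff ((\<phi> $ 1)\<^sup>2) \<beta>"
  define L where "L = mat n n (\<lambda>(a, m). c a m)"
  define V where "V = mat n n (\<lambda>(m, b). fact (2 * b + 1) * (\<phi> ^ (2 * m + 1)) $ (2 * b + 1))"
  have carr: "L \<in> carrier_mat n n" "V \<in> carrier_mat n n"
    by (simp_all add: L_def V_def)
  have entry: "fact (2 * (a + b) + 1) * \<phi> $ (2 * (a + b) + 1) =
      (\<Sum>m<n. c a m * (fact (2 * b + 1) * (\<phi> ^ (2 * m + 1)) $ (2 * b + 1)))" if "a < n" for a b
  proof -
    have "fact (2 * (a + b) + 1) * \<phi> $ (2 * (a + b) + 1) = (fps_deriv ^^ ((2 * b + 1) + 2 * a)) \<phi> $ 0"
      by (subst fps_0th_higher_deriv) (simp add: algebra_simps)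
    also have "\<dots> = (fps_deriv ^^ (2 * b + 1)) ((fps_deriv ^^ (2 * a)) \<phi>) $ 0"
      by (simp only: funpow_add o_def)
    also have "\<dots> = fact (2 * b + 1) * (\<Sum>m\<le>a. c a m * (\<phi> ^ (2 * m + 1)) $ (2 * b + 1))"
      by (subst fps_0th_higher_deriv, subst fps_deriv_even_expand[OF assms])
         (simp add: c_def fps_sum_nth del: power_Suc)
    also have "(\<Sum>m\<le>a. c a m * (\<phi> ^ (2 * m + 1)) $ (2 * b + 1)) =
        (\<Sum>m<n. c a m * (\<phi> ^ (2 * m + 1)) $ (2 * b + 1))"
      using that by (intro sum.mono_neutral_left) (auto simp: c_def odd_power_coeff_eq_0)
    finally show ?thesis
      by (simp only: sum_distrib_left mult_ac)
  qed
  have "mat n n (\<lambda>(a, b). fact (2 * (a + b) + 1) * \<phi> $ (2 * (a + b) + 1)) = L * V"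
    by (rule eq_matI) (use entry in \<open>simp_all add: L_def V_def scalar_prod_def lessThan_atLeast0\<close>)
  moreover have "Determinant.det L = (\<Prod>a<n. fact (2 * a) / 4 ^ a)"
    by (subst det_lower_triangular[OF _ carr(1)])
       (auto simp: L_def c_def odd_power_coeff_eq_0 odd_power_coeff_diag prod_list_diag_prod lessThan_atLeast0)
  moreover have "Determinant.det V = (\<Prod>a<n. fact (2 * a + 1) * (\<phi> $ 1) ^ (2 * a + 1))"
    using fps_power_nth_below[OF zero]
    by (subst det_upper_triangular[OF _ carr(2)])
       (auto simp: V_def prod_list_diag_prod lessThan_atLeast0 simp del: power_Suc fact_Suc)
  ultimately show ?thesis
    by (simp add: det_mult[OF carr] prod.distrib[symmetric] mult.assoc del: power_Suc fact_Suc)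
qed

text \<open>The factorials of 2a and 2a+1 for a < n are those of all r < 2n, so they cancel. The
  power of 2 absorbs 4 from the scaling of each row, 4^a from the lower and 2^(2a+1) from the upper
  diagonal: the exponents 4a+3 add up to 2n^2+n. The parameter \<open>t\<close> will be 1 for tanh
  and the theta value for the elliptic function.\<close>

lemma normalized_hankel_det:
  fixes \<phi> :: "'a::field_char_0 fps"
  assumes zero: "\<phi> $ 0 = 0"
    and ode: "fps_deriv (fps_deriv \<phi>) = fps_const \<beta> * \<phi> + fps_const (1/2) * \<phi> ^ 3"
    and lead: "\<phi> $ 1 = t ^ 4 / 2"
  shows "2 ^ (2 * n\<^sup>2 + n) * (\<Prod>r = 1..2 * n - 1. inverse (fact r)) *
    Determinant.det (mat n n (\<lambda>(a, b). fact (2 * (a + b) + 1) * \<phi> $ (2 * (a + b) + 1) / 4)) = t ^ (4 * n\<^sup>2)"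
proof -
  define P :: "nat \<Rightarrow> 'a" where "P = (\<lambda>n. \<Prod>a<n. fact (2 * a) * fact (2 * a + 1) * (t ^ 4 / 2) ^ (2 * a + 1) / 4 ^ a)"
  have mat: "mat n n (\<lambda>(a, b). fact (2 * (a + b) + 1) * \<phi> $ (2 * (a + b) + 1) / 4) =
      (1/4) \<cdot>\<^sub>m mat n n (\<lambda>(a, b). fact (2 * (a + b) + 1) * \<phi> $ (2 * (a + b) + 1))"
    by (rule eq_matI) auto
  have det: "Determinant.det (mat n n (\<lambda>(a, b). fact (2 * (a + b) + 1) * \<phi> $ (2 * (a + b) + 1) / 4)) =
      (1/4) ^ n * P n"
    by (simp only: mat det_smult dim_col_mat hankel_det_of_ode[OF zero ode] lead P_def)
  have "{..<2 * n} = insert 0 {1..2 * n - 1}" if "n > 0"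
    using that by auto
  hence prod_eq: "(\<Prod>r = 1..2 * n - 1. inverse (fact r :: 'a)) = (\<Prod>r<2 * n. inverse (fact r))"
    by (cases "n = 0") (auto simp: prod.insert_if)
  have "2 ^ (2 * n\<^sup>2 + n) * (\<Prod>r<2 * n. inverse (fact r :: 'a)) * ((1/4) ^ n * P n) = t ^ (4 * n\<^sup>2)"
  proof (induction n)
    case 0
    show ?case by (simp add: P_def)
  next
    case (Suc n)
    have exps: "2 * (Suc n)\<^sup>2 + Suc n = (2 * n\<^sup>2 + n) + (4 * n + 3)" "4 * (Suc n)\<^sup>2 = 4 * n\<^sup>2 + 4 * (2 * n + 1)"
      by (simp_all add: power2_eq_square)
    have two: "2 ^ (4 * n + 3) * (1/4) * (1 / 2 ^ (2 * n + 1) / 4 ^ n) = (1 :: 'a)"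
    proof -
      have "(4 :: 'a) ^ n = 2 ^ (2 * n)"
        by (simp add: power_mult)
      moreover have "(2 :: 'a) ^ (4 * n + 3) = 2 ^ (2 * n + 1) * 2 ^ (2 * n) * 2 ^ 2"
      proof -
        have "4 * n + 3 = 2 * n + 1 + 2 * n + 2" by simp
        thus ?thesis by (simp only: power_add)
      qed
      ultimately show ?thesis by simp
    qed
    have P_Suc: "P (Suc n) = P n * (fact (2 * n) * fact (2 * n + 1) * (t ^ 4 / 2) ^ (2 * n + 1) / 4 ^ n)"
      by (simp add: P_def del: fact_Suc power_Suc)
    have prod_Suc: "(\<Prod>r<2 * Suc n. inverse (fact r :: 'a)) =
        (\<Prod>r<2 * n. inverse (fact r)) * inverse (fact (2 * n)) * inverse (fact (2 * n + 1))"
      by (simp del: fact_Suc)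
    have "2 ^ (2 * (Suc n)\<^sup>2 + Suc n) * (\<Prod>r<2 * Suc n. inverse (fact r :: 'a)) * ((1/4) ^ Suc n * P (Suc n)) =
        (2 ^ (2 * n\<^sup>2 + n) * (\<Prod>r<2 * n. inverse (fact r)) * ((1/4) ^ n * P n)) *
        (2 ^ (4 * n + 3) * (1/4) * (1 / 2 ^ (2 * n + 1) / 4 ^ n)) *
        ((inverse (fact (2 * n)) * fact (2 * n)) * (inverse (fact (2 * n + 1)) * fact (2 * n + 1))) * (t ^ 4) ^ (2 * n + 1)"
      unfolding exps power_add[of 2 "2 * n\<^sup>2 + n"] P_Suc prod_Suc power_Suc[of "1 / 4"]
      unfolding power_divide power_one
      by (simp only: divide_inverse mult_1_left mult_1_right mult_ac)
    also have "\<dots> = t ^ (4 * (Suc n)\<^sup>2)"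
      unfolding Suc two by (simp add: exps(2) power_add del: fact_Suc flip: power_mult)
    finally show ?case .
  qed
  thus ?thesis
    unfolding det prod_eq .
qed

text \<open>In the Leibniz formula the product over the rows is multiplied out; \<open>S\<close> is
  the set of rows from which the entry of \<open>x\<close> is taken, each with a minus sign.\<close>

lemma det_row_diff:
  fixes x y :: "nat \<Rightarrow> nat \<Rightarrow> 'a::comm_ring_1"
  shows "Determinant.det (mat n n (\<lambda>(a, b). y a b - x a b)) =
    (\<Sum>S\<in>Pow {0..<n}. (-1) ^ card S * Determinant.det (mat n n (\<lambda>(a, b). if a \<in> S then x a b else y a b)))"
proof -
  let ?P = "{p. p permutes {0..<n}}"
  have lt: "p i < n" if "p permutes {0..<n}" "i < n" for p :: "nat \<Rightarrow> nat" and i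
    using permutes_in_image[OF that(1), of i] that(2) by auto
  have split: "(\<Prod>i = 0..<n. y i (p i) - x i (p i)) =
      (\<Sum>S\<in>Pow {0..<n}. (-1) ^ card S * (\<Prod>i = 0..<n. if i \<in> S then x i (p i) else y i (p i)))" for p
  proof -
    have "(\<Prod>i = 0..<n. y i (p i) - x i (p i)) = (\<Prod>i = 0..<n. - x i (p i) + y i (p i))"
      by simp
    also have "\<dots> = (\<Sum>S\<in>Pow {0..<n}. (\<Prod>i\<in>S. - x i (p i)) * (\<Prod>i\<in>{0..<n} - S. y i (p i)))"
      by (rule prod_add) simp
    also have "\<dots> = (\<Sum>S\<in>Pow {0..<n}. (-1) ^ card S * (\<Prod>i = 0..<n. if i \<in> S then x i (p i) else y i (p i)))"
    proof (rule sum.cong)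
      fix S assume "S \<in> Pow {0..<n}"
      hence "{0..<n} \<inter> S = S" "{0..<n} \<inter> - S = {0..<n} - S"
        by auto
      thus "(\<Prod>i\<in>S. - x i (p i)) * (\<Prod>i\<in>{0..<n} - S. y i (p i)) =
          (-1) ^ card S * (\<Prod>i = 0..<n. if i \<in> S then x i (p i) else y i (p i))"
        by (simp add: prod.If_cases prod_uminus mult_ac)
    qed simp
    finally show ?thesis .
  qed
  have "Determinant.det (mat n n (\<lambda>(a, b). y a b - x a b)) =
      (\<Sum>p\<in>?P. signof p * (\<Prod>i = 0..<n. y i (p i) - x i (p i)))"
    by (subst det_def'[of _ n]) (auto intro!: sum.cong prod.cong simp: lt)
  also have "\<dots> = (\<Sum>S\<in>Pow {0..<n}. (-1) ^ card S *
      (\<Sum>p\<in>?P. signof p * (\<Prod>i = 0..<n. if i \<in> S then x i (p i) else y i (p i))))"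
    unfolding split sum_distrib_left by (subst sum.swap) (simp add: mult_ac)
  also have "\<dots> = (\<Sum>S\<in>Pow {0..<n}. (-1) ^ card S *
      Determinant.det (mat n n (\<lambda>(a, b). if a \<in> S then x a b else y a b)))"
    by (intro sum.cong refl arg_cong2[of _ _ _ _ "(*)"], subst det_def'[of _ n])
       (auto intro!: sum.cong prod.cong simp: lt)
  finally show ?thesis .
qed

lemma det_bern_c_diff_lambertU:
  "Determinant.det (mat n n (\<lambda>(a, b). of_real (bern_c (a + b + 1)) - lambertU (2 * (a + b) + 1) q)) =
    (\<Sum>S\<in>Pow {1..n}. (-1) ^ card S * Determinant.det (mat_M n S q))"
proof -
  have "bij_betw (image Suc) (Pow {0..<n}) (Pow {1..n})"
    by (rule bij_betw_Pow) (auto simp: bij_betw_def image_Suc_atLeastLessThan atLeastLessThanSuc_atLeastAtMost)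
  hence "(\<Sum>S\<in>Pow {1..n}. (-1) ^ card S * Determinant.det (mat_M n S q)) =
      (\<Sum>S\<in>Pow {0..<n}. (-1) ^ card (Suc ` S) * Determinant.det (mat_M n (Suc ` S) q))"
    by (rule sum.reindex_bij_betw[symmetric])
  also have "\<dots> = (\<Sum>S\<in>Pow {0..<n}. (-1) ^ card S *
      Determinant.det (mat n n (\<lambda>(a, b). if a \<in> S then lambertU (2 * (a + b) + 1) q else of_real (bern_c (a + b + 1)))))"
  proof (intro sum.cong refl arg_cong2[of _ _ _ _ "(*)"])
    fix S :: "nat set"
    show "(-1) ^ card (Suc ` S) = ((-1) ^ card S :: complex)"
      by (simp add: card_image)
    show "Determinant.det (mat_M n (Suc ` S) q) = 
      Determinant.det (mat n n (\<lambda>(a, b). if a \<in> S then lambertU (2 * (a + b) + 1) q else of_real (bern_c (a + b + 1))))"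
      by (rule arg_cong[of _ _ Determinant.det], rule eq_matI)
         (auto simp: mat_M_def Let_def image_iff algebra_simps)
  qed
  finally show ?thesis
    by (rule trans[OF det_row_diff sym])
qed

subsection \<open>The hyperbolic tangent\<close>

definition fps_tanh_half :: "'a::field_char_0 fps" where
  "fps_tanh_half = (fps_exp 1 - 1) * inverse (fps_exp 1 + 1)"

lemma fps_exp_plus_1_nz: "fps_exp 1 + 1 \<noteq> (0 :: 'a::field_char_0 fps)"
proof
  assume "fps_exp 1 + 1 = (0 :: 'a fps)"
  hence "(fps_exp 1 + 1) $ 0 = (0 :: 'a)" by simp
  thus False by simp
qed

lemma fps_tanh_half_mult: "fps_tanh_half * (fps_exp 1 + 1) = (fps_exp 1 - 1 :: 'a::field_char_0 fps)"
  by (simp add: fps_tanh_half_def mult.assoc inverse_mult_eq_1)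

lemma fps_tanh_half_deriv:
  "fps_deriv fps_tanh_half = fps_const (1/2) * (1 - fps_tanh_half ^ 2 :: 'a::field_char_0 fps)"
proof -
  define T E h :: "'a fps" where "T = fps_tanh_half" and "E = fps_exp 1" and "h = fps_const (1/2)"
  have h: "2 * h = 1"
    by (simp add: h_def numeral_fps_const)
  have 1: "T * (E + 1) = E - 1"
    unfolding T_def E_def by (rule fps_tanh_half_mult)
  have E': "fps_deriv E = E"
    by (simp add: E_def)
  have "fps_deriv (T * (E + 1)) = fps_deriv (E - 1)"
    by (simp only: 1)
  hence "fps_deriv T * (E + 1) = E - T * E"
    by (simp add: E' algebra_simps)
  \<comment> \<open>Multiplication by \<open>(E + 1) ^ 2\<close> clears the denominators; up to the
    factor 1/2 the claim is then 4 E = (E + 1)^2 - (E - 1)^2.\<close>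
  hence "(E + 1) ^ 2 * fps_deriv T = (E + 1) * (E - T * E)"
    by (simp add: power2_eq_square mult_ac)
  also have "\<dots> = E * ((E + 1) - T * (E + 1))"
    by (simp add: algebra_simps)
  also have "\<dots> = 2 * h * (2 * E)"
    unfolding 1 h by simp
  also have "\<dots> = h * ((E + 1) ^ 2 - (T * (E + 1)) ^ 2)"
    unfolding 1 by (simp add: power2_eq_square algebra_simps)
  also have "\<dots> = (E + 1) ^ 2 * (h * (1 - T ^ 2))"
    by (simp add: power2_eq_square algebra_simps)
  finally have "(E + 1) ^ 2 * fps_deriv T = (E + 1) ^ 2 * (h * (1 - T ^ 2))" .
  thus ?thesis
    using fps_exp_plus_1_nz[where ?'a = 'a] by (simp add: T_def h_def E_def)
qed

lemma fps_tanh_half_0: "fps_tanh_half $ 0 = (0 :: 'a::field_char_0)"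
  using arg_cong[OF fps_tanh_half_mult[where ?'a = 'a], of "\<lambda>f. f $ 0"] by simp

lemma fps_tanh_half_1: "fps_tanh_half $ 1 = (1 / 2 :: 'a::field_char_0)"
  using arg_cong[OF fps_tanh_half_deriv[where ?'a = 'a], of "\<lambda>f. f $ 0"]
  by (simp add: fps_tanh_half_0 power2_eq_square)

lemma fps_tanh_half_ode:
  "fps_deriv (fps_deriv fps_tanh_half) =
    fps_const (- 1 / 2) * fps_tanh_half + fps_const (1/2) * (fps_tanh_half ^ 3 :: 'a::field_char_0 fps)"
proof -
  define T h :: "'a fps" where "T = fps_tanh_half" and "h = fps_const (1/2)"
  have h: "2 * h = 1"
    by (simp add: h_def numeral_fps_const)
  have T': "fps_deriv T = h * (1 - T * T)"
    by (simp add: T_def h_def fps_tanh_half_deriv power2_eq_square)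
  have "fps_deriv (fps_deriv T) = h * - (2 * h * (1 - T * T) * T)"
    unfolding T' by (simp add: h_def[symmetric] T') (simp add: h_def T' algebra_simps)
  also have "\<dots> = - h * T + h * T ^ 3"
    unfolding h by (simp add: algebra_simps power3_eq_cube)
  also have "- h = fps_const (- 1 / 2)"
    by (simp add: h_def)
  finally show ?thesis
    by (simp only: T_def h_def)
qed

text \<open>Signs of coefficients need an ordered field, while the determinants are complex. The
  defining quotient is unique, so the real coefficients carry over.\<close>

lemma fps_tanh_half_of_real: "fps_tanh_half $ n = complex_of_real (fps_tanh_half $ n)"
proof -
  define R where "R = Abs_fps (\<lambda>n. complex_of_real (fps_tanh_half $ n))"
  have "R * (fps_exp 1 + 1) = fps_exp 1 - 1"
  proof (rule fps_ext)
    fix n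
    have "(R * (fps_exp 1 + 1)) $ n = of_real ((fps_tanh_half * (fps_exp 1 + 1)) $ n)"
      by (auto simp: fps_mult_nth R_def intro!: sum.cong)
    thus "(R * (fps_exp 1 + 1)) $ n = (fps_exp 1 - 1) $ n"
      unfolding fps_tanh_half_mult by simp
  qed
  hence "R = fps_tanh_half"
    using fps_tanh_half_mult[where ?'a = complex] fps_exp_plus_1_nz[where ?'a = complex]
    by (metis mult_right_cancel)
  hence "R $ n = fps_tanh_half $ n"
    by simp
  thus ?thesis
    by (simp add: R_def)
qed

text \<open>T' = (1 - T^2) / 2 is a recursion for the coefficients. Odd indices 2j+1 and 2l+1 with
  sum 2k satisfy j + l + 1 = k, so every product in the convolution has sign opposite to (-1)^k and
  the minus sign restores it. This determines the signs of the Bernoulli numbers and thereby removes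
  the absolute value in \<open>bern_c\<close>.\<close>

lemma fps_tanh_half_sign:
  "(even n \<longrightarrow> fps_tanh_half $ n = (0 :: real)) \<and> (-1) ^ (n div 2) * fps_tanh_half $ n \<ge> (0 :: real)"
proof (induction n rule: less_induct)
  case (less n)
  show ?case
  proof (cases n)
    case 0
    thus ?thesis by (simp add: fps_tanh_half_0)
  next
    case (Suc m)
    define T :: "real fps" where "T = fps_tanh_half"
    have "of_nat n * T $ n = fps_deriv T $ m"
      by (simp add: Suc)
    also have "\<dots> = (1/2) * ((if m = 0 then 1 else 0) - (\<Sum>i=0..m. T $ i * T $ (m - i)))"
      unfolding T_def fps_tanh_half_deriv fps_mult_left_const_nth power2_eq_square
      by (simp add: fps_mult_nth)
    finally have rec: "of_nat n * T $ n = (1/2) * ((if m = 0 then 1 else 0) - (\<Sum>i=0..m. T $ i * T $ (m - i)))" .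
    show ?thesis
    proof (cases "even n")
      case True
      hence "T $ i * T $ (m - i) = 0" if "i \<le> m" for i
        using that less[of i] less[of "m - i"] Suc by (cases "even i") (auto simp: T_def)
      hence "(\<Sum>i=0..m. T $ i * T $ (m - i)) = 0"
        by (intro sum.neutral) auto
      moreover have "m \<noteq> 0"
        using True Suc by (intro notI) simp
      ultimately have "of_nat n * T $ n = 0"
        using rec by simp
      thus ?thesis
        using Suc by (simp add: T_def)
    next
      case False
      then obtain k where k: "m = 2 * k"
        using Suc by auto
      have neg: "(-1) ^ k * (T $ i * T $ (m - i)) \<le> 0" if "i \<le> m" for i
      proof (cases "even i")
        case True
        thus ?thesis using that less[of i] Suc by (auto simp: T_def)
      next
        case False
        then obtain j where j: "i = 2 * j + 1"
          using oddE by blast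
        have "j < k"
          using j k that by simp
        then obtain l where "k = Suc (j + l)"
          using less_iff_Suc_add by blast
        hence l: "m - i = 2 * l + 1" "k = j + l + 1"
          using j k by simp_all
        have "0 \<le> (-1) ^ j * T $ i"
          using less[of i] Suc j that by (simp add: T_def)
        moreover have "0 \<le> (-1) ^ l * T $ (m - i)"
          using less[of "m - i"] Suc l by (simp add: T_def)
        ultimately have "0 \<le> ((-1) ^ j * T $ i) * ((-1) ^ l * T $ (m - i))"
          by (rule mult_nonneg_nonneg)
        thus ?thesis
          by (simp add: l(2) power_add mult_ac)
      qed
      have "(-1) ^ k * (of_nat n * T $ n) = (1/2) * ((-1) ^ k * (if m = 0 then 1 else 0) - (\<Sum>i=0..m. (-1) ^ k * (T $ i * T $ (m - i))))"
        unfolding rec by (simp add: sum_distrib_left right_diff_distrib)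
      also have "\<dots> \<ge> 0"
        using sum_nonpos[of "{0..m}" "\<lambda>i. (-1) ^ k * (T $ i * T $ (m - i))"] neg k by auto
      finally have "0 \<le> of_nat n * ((-1) ^ k * T $ n)"
        by (simp add: mult_ac)
      hence "0 \<le> (-1) ^ k * T $ n"
        using Suc by (simp add: zero_le_mult_iff)
      thus ?thesis
        using False Suc k by (simp add: T_def)
    qed
  qed
qed

text \<open>Partial fractions: tanh (x/2) = 1 - 2 / (e^x - 1) + 4 / (e^(2x) - 1). Multiplied by x,
  the two fractions are the Bernoulli series \<open>B\<close> at x and, as \<open>R\<close>, at
  2x.\<close>

lemma fps_tanh_half_bernoulli:
  assumes "n > 0"
  shows "fps_tanh_half $ n = 2 * (2 ^ Suc n - 1) * bernoulli (Suc n) / fact (Suc n)"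
proof -
  define E B :: "real fps" where "E = fps_exp 1" and "B = fps_X / (fps_exp 1 - 1)"
  have sub: "subdegree (E - 1) = 1"
    by (auto intro!: subdegreeI simp: E_def)
  hence nz: "E - 1 \<noteq> 0"
    by auto
  hence B: "B * (E - 1) = fps_X"
    unfolding B_def E_def using sub by (simp add: fps_dvd_iff E_def)
  define R where "R = fps_compose B (fps_const 2 * fps_X)"
  have "fps_compose (B * (E - 1)) (fps_const 2 * fps_X) = fps_compose fps_X (fps_const 2 * fps_X)"
    by (simp only: B)
  hence "R * (fps_exp 2 - 1) = fps_const 2 * fps_X"
    by (simp add: R_def fps_compose_mult_distrib fps_compose_sub_distrib E_def fps_exp_compose_linear)
  moreover have "fps_exp 2 = E * E"
    by (simp add: E_def flip: fps_exp_add_mult)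
  ultimately have R: "R * (E * E - 1) = 2 * fps_X"
    by (simp add: numeral_fps_const)
  have T: "fps_tanh_half * (E + 1) = E - 1"
    unfolding E_def by (rule fps_tanh_half_mult)
  have "(E * E - 1) * (fps_X * fps_tanh_half) = (E * E - 1) * (fps_X - 2 * (B - R))"
  proof -
    have "(E * E - 1) * (fps_X * fps_tanh_half) = (E - 1) * fps_X * (fps_tanh_half * (E + 1))"
      by (simp add: algebra_simps)
    also have "\<dots> = (E * E - 1) * fps_X - 2 * (E + 1) * fps_X + 2 * (2 * fps_X)"
      unfolding T by (simp add: algebra_simps)
    also have "\<dots> = (E * E - 1) * fps_X - 2 * (E + 1) * (B * (E - 1)) + 2 * (R * (E * E - 1))"
      unfolding B R ..
    also have "\<dots> = (E * E - 1) * (fps_X - 2 * (B - R))"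
      by (simp add: algebra_simps)
    finally show ?thesis .
  qed
  moreover have "E * E - 1 \<noteq> 0"
    using nz fps_exp_plus_1_nz[where ?'a = real] unfolding E_def
    by (simp add: square_diff_one_factored)
  ultimately have "fps_X * fps_tanh_half = fps_X - 2 * (B - R)"
    by simp
  hence "(fps_X * fps_tanh_half) $ Suc n = (fps_X - 2 * (B - R)) $ Suc n"
    by simp
  hence "fps_tanh_half $ n = - 2 * (B $ Suc n - R $ Suc n)"
    using assms by (simp add: numeral_fps_const)
  moreover have "R $ Suc n = 2 ^ Suc n * B $ Suc n"
    unfolding R_def fps_compose_linear by (simp only: fps_nth_Abs_fps)
  moreover have "B $ Suc n = bernoulli (Suc n) / fact (Suc n)"
    by (simp add: bernoulli_def B_def del: fact_Suc)
  ultimately show ?thesis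
    by (simp add: field_simps del: fact_Suc)
qed

lemma fps_tanh_half_bern_c:
  "fact (2 * k + 1) * fps_tanh_half $ (2 * k + 1) = complex_of_real (4 * bern_c (k + 1))"
proof -
  define b where "b = bernoulli (2 * k + 2)"
  have T: "fps_tanh_half $ (2 * k + 1) = 2 * (2 ^ (2 * k + 2) - 1) * b / fact (2 * k + 2)"
    using fps_tanh_half_bernoulli[of "2 * k + 1"] by (simp add: b_def)
  have "0 \<le> (-1) ^ k * (fps_tanh_half :: real fps) $ (2 * k + 1)"
    using fps_tanh_half_sign[of "2 * k + 1"] by simp
  also have "\<dots> = (2 * (2 ^ (2 * k + 2) - 1) / fact (2 * k + 2)) * ((-1) ^ k * b)"
    unfolding T by (simp only: times_divide_eq_left times_divide_eq_right mult_ac)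
  finally have "(-1) ^ k * b \<ge> 0"
    using one_less_power[of "2::real" "2 * k + 2"]
    by (subst (asm) zero_le_mult_iff) (auto simp: divide_simps)
  hence b: "(-1) ^ k * \<bar>b\<bar> = b"
    by (cases "even k") auto
  have "fact (2 * k + 1) * fps_tanh_half $ (2 * k + 1) = (2 * (2 ^ (2 * k + 2) - 1) * b) / (2 * k + 2)"
  proof -
    have fact: "fact (2 * k + 2) = (2 * k + 2) * (fact (2 * k + 1) :: real)"
      by (simp add: algebra_simps)
    have cancel: "F * (X / (D * F)) = X / D" if "F \<noteq> 0" for F X D :: real
      using that by simp
    show ?thesis
      unfolding T fact by (rule cancel[OF fact_nonzero])
  qed
  also have "\<dots> = 4 * (((-1) ^ k * \<bar>b\<bar>) * ((2 ^ (2 * k + 2) - 1) / (4 * (k + 1))))"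
    unfolding b by (simp add: field_simps)
  also have "\<dots> = 4 * bern_c (k + 1)"
    by (simp add: bern_c_def b_def)
  finally show ?thesis
    by (subst fps_tanh_half_of_real) (metis of_real_fact of_real_mult)
qed

subsection \<open>Four squares\<close>

lemma norm_power_less_1:
  fixes q :: "'a::real_normed_div_algebra"
  assumes "norm q < 1" "n > 0"
  shows "norm (q ^ n) < 1"
  using assms by (simp add: norm_power power_less_one_iff)

lemma one_minus_power_nz:
  fixes q :: "'a::real_normed_div_algebra"
  assumes "norm q < 1" "n > 0"
  shows "1 - q ^ n \<noteq> 0"
  using norm_power_less_1[OF assms] by auto

lemma one_plus_power_nz:
  fixes q :: "'a::{real_normed_field}"
  assumes "norm q < 1"
  shows "1 + q ^ n \<noteq> 0"
proof (cases "n = 0")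
  case False
  thus ?thesis using norm_power_less_1[OF assms, of n] by (metis add_eq_0_iff2 less_irrefl neq0_conv norm_minus_cancel norm_one)
qed auto

text \<open>The finite q-Pochhammer symbol (-a q; q)_n. It is used at \<open>a = - 1\<close> and
  \<open>a = 1\<close>, for the products of 1 - q^k and of 1 + q^k.\<close>

definition qprod :: "complex \<Rightarrow> complex \<Rightarrow> nat \<Rightarrow> complex" where
  "qprod a q n = (\<Prod>k<n. 1 + a * q ^ Suc k)"

lemma qprod_0 [simp]: "qprod a q 0 = 1"
  by (simp add: qprod_def)

lemma qprod_Suc: "qprod a q (Suc n) = qprod a q n * (1 + a * q ^ Suc n)"
  by (simp add: qprod_def)

lemma qprod_factor_nz:
  fixes q a :: complex
  assumes "norm q < 1" "norm a \<le> 1"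
  shows "1 + a * q ^ Suc k \<noteq> 0"
proof
  assume "1 + a * q ^ Suc k = 0"
  hence "a * q ^ Suc k = - 1"
    by (simp add: eq_neg_iff_add_eq_0 add.commute)
  hence "norm (a * q ^ Suc k) = norm (- 1 :: complex)"
    by (simp only:)
  hence "norm (a * q ^ Suc k) = 1"
    unfolding norm_minus_cancel norm_one .
  moreover have "norm (a * q ^ Suc k) \<le> 1 * norm (q ^ Suc k)"
    unfolding norm_mult by (rule mult_right_mono) (use assms in auto)
  ultimately show False
    using norm_power_less_1[OF assms(1), of "Suc k"] by simp
qed

lemma qprod_limit:
  assumes "norm q < 1" "norm a \<le> 1"
  obtains L where "qprod a q \<longlonglongrightarrow> L" "L \<noteq> 0"
proof -
  let ?f = "\<lambda>k. 1 + a * q ^ Suc k"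
  have "summable (\<lambda>k. norm a * norm q ^ Suc k)"
    using assms by (intro summable_mult summable_ignore_initial_segment[of _ 1, simplified] summable_geometric) auto
  hence "summable (\<lambda>k. norm (?f k - 1))"
    by (simp add: norm_mult norm_power)
  hence conv: "convergent_prod ?f"
    by (intro abs_convergent_prod_imp_convergent_prod summable_imp_abs_convergent_prod)
  have "(\<lambda>n. \<Prod>k<Suc n. ?f k) \<longlonglongrightarrow> prodinf ?f"
    using convergent_prod_LIMSEQ[OF conv] by (simp add: lessThan_Suc_atMost)
  hence "qprod a q \<longlonglongrightarrow> prodinf ?f"
    unfolding qprod_def by (subst (asm) filterlim_sequentially_Suc)
  thus ?thesis
    using that prodinf_nonzero[OF conv qprod_factor_nz[OF assms]] by blast
qed

text \<open>Dominated convergence for series: for fixed j both factors tend to \<open>L\<close>, and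
  a bound \<open>M\<close> of \<open>w\<close> yields the summable majorant M^2 |c j|. The left
  sides of both terminating identities have this shape.\<close>

lemma tendsto_convolution:
  fixes c w :: "nat \<Rightarrow> 'a::{real_normed_field,banach}"
  assumes w: "w \<longlonglongrightarrow> L" and c: "summable (\<lambda>j. norm (c j))"
  shows "(\<lambda>n. \<Sum>j\<le>n. c j * (w (n - j) * w (n + j))) \<longlonglongrightarrow> (\<Sum>j. c j) * L\<^sup>2"
proof -
  obtain M where M: "norm (w n) \<le> M" "M > 0" for n
    using convergent_imp_Bseq[OF convergentI[OF w]] by (auto simp: Bseq_def)
  define a where "a = (\<lambda>j n. if j \<le> n then c j * (w (n - j) * w (n + j)) else 0)"
  have "(a j \<longlongrightarrow> c j * (L * L)) sequentially" for j
  proof -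
    have "(\<lambda>n. c j * (w (n - j) * w (n + j))) \<longlonglongrightarrow> c j * (L * L)"
      using filterlim_compose[OF w filterlim_minus_const_nat_at_top[of j]]
      by (intro tendsto_mult tendsto_const LIMSEQ_ignore_initial_segment w)
    moreover have "eventually (\<lambda>n. a j n = c j * (w (n - j) * w (n + j))) sequentially"
      using eventually_ge_at_top[of j] by eventually_elim (simp add: a_def)
    ultimately show ?thesis
      by (simp add: filterlim_cong)
  qed
  moreover have "norm (a j n) \<le> norm (c j) * (M * M)" for j n
    using M by (auto simp: a_def norm_mult intro!: mult_mono)
  hence "eventually (\<lambda>(j, n). norm (a j n) \<le> norm (c j) * (M * M)) (at_top \<times>\<^sub>F sequentially)"
    by (intro always_eventually) auto
  moreover have "summable (\<lambda>j. norm (c j) * (M * M))"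
    by (intro summable_mult2 c)
  ultimately have "(\<lambda>n. suminf (\<lambda>j. a j n)) \<longlonglongrightarrow> (\<Sum>j. c j * (L * L))"
    using tannerys_theorem[of a "\<lambda>j. c j * (L * L)" sequentially "\<lambda>j. norm (c j) * (M * M)"] by simp
  moreover have "suminf (\<lambda>j. a j n) = (\<Sum>j\<le>n. c j * (w (n - j) * w (n + j)))" for n
    by (subst suminf_finite[of "{..n}"]) (auto simp: a_def)
  moreover have "(\<Sum>j. c j * (L * L)) = (\<Sum>j. c j) * L\<^sup>2"
    using c by (simp add: suminf_mult2[symmetric] summable_norm_cancel power2_eq_square)
  ultimately show ?thesis
    by simp
qed

text \<open>
  The weight of \<open>j\<close> when a sum of even terms with signs \<open>(- 1) ^ j\<close> over all integers is folded onto the naturals.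
\<close>

definition fold_sign :: "nat \<Rightarrow> complex" where
  "fold_sign j = (if j = 0 then 1 else 2 * (-1) ^ j)"

lemma norm_fold_sign_le: "norm (fold_sign j) \<le> 2"
  by (simp add: fold_sign_def norm_mult norm_power)

lemma summable_fold_sign_mult:
  assumes "summable (\<lambda>j. norm (c j))"
  shows "summable (\<lambda>j. norm (fold_sign j * c j))"
proof (rule summable_comparison_test')
  show "summable (\<lambda>j. 2 * norm (c j))"
    by (intro summable_mult assms)
  show "norm (norm (fold_sign j * c j)) \<le> 2 * norm (c j)" for j
    using norm_fold_sign_le by (auto simp: norm_mult intro: mult_right_mono)
qed

lemma theta3_0_minus_eq:
  assumes "norm q < 1"
  shows "theta3_0 (- q) = (\<Sum>j. fold_sign j * q ^ (j\<^sup>2))" and "summable (\<lambda>j. norm (fold_sign j * q ^ (j\<^sup>2)))"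
proof -
  define f where "f = (\<lambda>j :: nat. (-1) ^ j * q ^ (j\<^sup>2))"
  have "summable (\<lambda>j. norm (q ^ (j\<^sup>2)))"
  proof (rule summable_comparison_test')
    show "summable (\<lambda>j. norm q ^ j)"
      using assms by (intro summable_geometric) simp
    show "norm (norm (q ^ (j\<^sup>2))) \<le> norm q ^ j" for j
      using assms by (auto simp: norm_power power2_eq_square intro!: power_decreasing)
  qed
  note sq = this
  show sum': "summable (\<lambda>j. norm (fold_sign j * q ^ (j\<^sup>2)))"
    by (rule summable_fold_sign_mult[OF sq])
  have sf: "summable (\<lambda>j. norm (f j))"
    using sq by (simp add: f_def norm_mult norm_power)
  hence sf': "summable (\<lambda>j. norm (f (Suc j)))"
    by (subst summable_Suc_iff)
  define F where "F = (\<lambda>j :: int. (- q) powi (j ^ 2))"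
  have F: "F (int j) = f j" "F (- int j) = f j" for j
  proof -
    have "(- q) ^ (j\<^sup>2) = ((-1) ^ (j\<^sup>2)) * q ^ (j\<^sup>2)"
      by (metis power_minus)
    moreover have "(-1 :: complex) ^ (j\<^sup>2) = (-1) ^ j"
      by (cases "even j") simp_all
    moreover have "(- q) powi (int j ^ 2) = (- q) ^ (j\<^sup>2)"
      by (metis of_nat_power power_int_of_nat)
    ultimately show "F (int j) = f j" "F (- int j) = f j"
      by (simp_all add: F_def f_def)
  qed
  have "(f has_sum suminf f) UNIV"
    using sf by (intro norm_summable_imp_has_sum summable_sums) (auto intro: summable_norm_cancel)
  hence "(F \<circ> int has_sum suminf f) UNIV"
    by (simp add: o_def F)
  hence 1: "(F has_sum suminf f) (range int)"
    by (subst has_sum_reindex) (auto simp: inj_on_def)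
  have "((\<lambda>j. f (Suc j)) has_sum (\<Sum>j. f (Suc j))) UNIV"
    using sf' by (intro norm_summable_imp_has_sum summable_sums) (auto intro: summable_norm_cancel)
  hence "(F \<circ> (\<lambda>j. - int (Suc j)) has_sum (\<Sum>j. f (Suc j))) UNIV"
    by (simp add: o_def F del: of_nat_Suc)
  hence 2: "(F has_sum (\<Sum>j. f (Suc j))) (range (\<lambda>j. - int (Suc j)))"
    by (subst has_sum_reindex) (auto simp: inj_on_def)
  have un: "range int \<union> range (\<lambda>j. - int (Suc j)) = UNIV"
  proof -
    have "x \<in> range int \<union> range (\<lambda>j. - int (Suc j))" for x
      by (cases x rule: int_cases) auto
    thus ?thesis by blast
  qed
  have "(F has_sum (suminf f + (\<Sum>j. f (Suc j)))) (range int \<union> range (\<lambda>j. - int (Suc j)))"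
    by (rule has_sum_Un_disjoint[OF 1 2]) auto
  hence "theta3_0 (- q) = suminf f + (\<Sum>j. f (Suc j))"
    unfolding theta3_0_def un F_def by (rule infsumI)
  also have "suminf f = f 0 + (\<Sum>j. f (Suc j))"
    using sf by (subst suminf_split_head) (auto intro: summable_norm_cancel)
  also have "f 0 + (\<Sum>j. f (Suc j)) + (\<Sum>j. f (Suc j)) = fold_sign 0 * q ^ (0\<^sup>2) + (\<Sum>j. fold_sign (Suc j) * q ^ ((Suc j)\<^sup>2))"
    using suminf_mult[OF summable_norm_cancel[OF sf'], of 2]
    by (simp add: f_def fold_sign_def mult.assoc)
  also have "\<dots> = (\<Sum>j. fold_sign j * q ^ (j\<^sup>2))"
    using suminf_split_head[OF summable_norm_cancel[OF sum']] by simp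
  finally show "theta3_0 (- q) = (\<Sum>j. fold_sign j * q ^ (j\<^sup>2))" .
qed

text \<open>
  Multiplied by \<open>1 - q ^ (2 * n)\<close>, the sum telescopes to the one for \<open>n - 1\<close>; \<open>G\<close> is the certificate.
\<close>

lemma finite_gauss:
  assumes q: "norm q < 1"
  defines "r \<equiv> \<lambda>n. 1 / qprod (-1) q n"
  shows "(\<Sum>j\<le>n. fold_sign j * q ^ (j\<^sup>2) * (r (n - j) * r (n + j))) = 1 / (qprod (-1) q n * qprod 1 q n)"
proof (induction n)
  case 0
  show ?case by (simp add: fold_sign_def r_def)
next
  case (Suc n)
  define N where "N = Suc n"
  define S where "S = (\<lambda>n. \<Sum>j\<le>n. fold_sign j * q ^ (j\<^sup>2) * (r (n - j) * r (n + j)))"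
  define x y where "x = (\<lambda>j. q ^ (N - j))" and "y = (\<lambda>j. q ^ (N + j))"
  define G where "G = (\<lambda>j. (-1) ^ j * q ^ (j\<^sup>2) * y j * (1 - x j) * (r (N - j) * r (N + j)))"
  have r: "r (Suc m) * (1 - q ^ Suc m) = r m" for m
    using one_minus_power_nz[OF q, of "Suc m"] by (simp add: r_def qprod_Suc)
  have xy: "x j * y j = q ^ (2 * N)" if "j \<le> N" for j
    using that by (simp add: x_def y_def mult_2 flip: power_add)
  have "S n = (\<Sum>j\<le>N. fold_sign j * q ^ (j\<^sup>2) * ((1 - x j) * (1 - y j) * (r (N - j) * r (N + j))))"
  proof -
    have "r (n - j) * r (n + j) = (1 - x j) * (1 - y j) * (r (N - j) * r (N + j))" if "j \<le> n" for j
      using r[of "n - j"] r[of "n + j"] that by (simp add: N_def x_def y_def Suc_diff_le mult_ac)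
    thus ?thesis
      by (simp add: S_def N_def x_def)
  qed
  hence "(1 - q ^ (2 * N)) * S N - S n =
      (\<Sum>j\<le>N. fold_sign j * q ^ (j\<^sup>2) * ((1 - q ^ (2 * N) - (1 - x j) * (1 - y j)) * (r (N - j) * r (N + j))))"
    by (simp add: S_def sum_distrib_left flip: sum_subtractf) (simp add: algebra_simps)
  also have "\<dots> = (\<Sum>j\<le>Suc n. fold_sign j * q ^ (j\<^sup>2) * ((x j * (1 - y j) + y j * (1 - x j)) * (r (N - j) * r (N + j))))"
  proof -
    have "1 - q ^ (2 * N) - (1 - x j) * (1 - y j) = x j * (1 - y j) + y j * (1 - x j)" if "j \<le> N" for j
      unfolding xy[OF that, symmetric] by (simp add: algebra_simps)
    thus ?thesis
      by (simp add: N_def)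
  qed
  \<comment> \<open>At \<open>j = 0\<close> the values \<open>x\<close> and \<open>y\<close>
    coincide, so the weight 1 there still gives \<open>2 * G 0\<close>, in step with the weight 2
    elsewhere. At the upper end \<open>G\<close> vanishes because \<open>x N = 1\<close>.\<close>
  also have "\<dots> = 2 * G 0 + (\<Sum>j\<le>n. 2 * (G (Suc j) - G j))"
  proof -
    have "fold_sign (Suc j) * q ^ ((Suc j)\<^sup>2) * ((x (Suc j) * (1 - y (Suc j)) + y (Suc j) * (1 - x (Suc j))) *
        (r (N - Suc j) * r (N + Suc j))) = 2 * (G (Suc j) - G j)" if "j \<le> n" for j
    proof -
      have "G j = (-1) ^ j * (q ^ (j\<^sup>2) * y j) * ((1 - x j) * r (N - j)) * r (N + j)"
        by (simp add: G_def)
      also have "(1 - x j) * r (N - j) = r (N - Suc j)"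
        using r[of "n - j"] that by (simp add: N_def x_def Suc_diff_le mult_ac)
      also have "r (N + j) = (1 - y (Suc j)) * r (N + Suc j)"
        using r[of "N + j"] by (simp add: y_def mult_ac)
      also have "q ^ (j\<^sup>2) * y j = q ^ ((Suc j)\<^sup>2) * x (Suc j)"
        using that by (simp add: y_def x_def N_def power2_eq_square algebra_simps flip: power_add)
      finally have Gj: "G j = - ((-1) ^ Suc j * q ^ ((Suc j)\<^sup>2) * x (Suc j) * (1 - y (Suc j)) * (r (N - Suc j) * r (N + Suc j)))"
        by (simp add: mult_ac)
      have GS: "G (Suc j) = (-1) ^ Suc j * q ^ ((Suc j)\<^sup>2) * y (Suc j) * (1 - x (Suc j)) * (r (N - Suc j) * r (N + Suc j))"
        by (simp add: G_def)
      show ?thesis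
        unfolding Gj GS by (simp add: fold_sign_def algebra_simps)
    qed
    moreover have "fold_sign 0 * q ^ (0\<^sup>2) * ((x 0 * (1 - y 0) + y 0 * (1 - x 0)) * (r (N - 0) * r (N + 0))) = 2 * G 0"
      by (simp add: G_def fold_sign_def x_def y_def)
    ultimately show ?thesis
      by (subst sum.atMost_Suc_shift) simp
  qed
  also have "(\<Sum>j\<le>n. 2 * (G (Suc j) - G j)) = 2 * (G (Suc n) - G 0)"
    unfolding sum_distrib_left[symmetric] using sum_telescope[of "\<lambda>j. - G j" n] by simp
  also have "G (Suc n) = 0"
    by (simp add: G_def x_def N_def)
  finally have "(1 - q ^ (2 * N)) * S N = S n"
    by simp
  moreover have "1 - q ^ (2 * N) = (1 - q ^ N) * (1 + q ^ N)"
    by (simp add: algebra_simps power_mult power2_eq_square flip: power_add)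
  ultimately have "((1 - q ^ N) * (1 + q ^ N)) * S N = S n"
    by simp
  moreover have "(1 - q ^ N) * (1 + q ^ N) \<noteq> 0"
    using one_minus_power_nz[OF q, of N] one_plus_power_nz[OF q, of N] by (simp add: N_def)
  ultimately have "S N = S n / ((1 - q ^ N) * (1 + q ^ N))"
    by (metis nonzero_mult_div_cancel_left)
  also have "S n = 1 / (qprod (-1) q n * qprod 1 q n)"
    unfolding S_def by (rule Suc)
  finally show ?case
    by (simp add: S_def N_def qprod_Suc mult_ac)
qed

text \<open>Gauss's product formula, as the limit of the terminating identity: its left side tends
  to theta / P^2 and its right side to 1 / (P B).\<close>

lemma theta3_0_minus_product:
  assumes q: "norm q < 1"
    and P: "qprod (-1) q \<longlonglongrightarrow> P" "P \<noteq> 0" and B: "qprod 1 q \<longlonglongrightarrow> B" "B \<noteq> 0"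
  shows "theta3_0 (- q) = P / B"
proof -
  have "(\<lambda>n. 1 / qprod (-1) q n) \<longlonglongrightarrow> 1 / P"
    by (intro tendsto_intros P)
  from tendsto_convolution[OF this theta3_0_minus_eq(2)[OF q]]
  have "(\<lambda>n. 1 / (qprod (-1) q n * qprod 1 q n)) \<longlonglongrightarrow> theta3_0 (- q) * (1 / P)\<^sup>2"
    unfolding finite_gauss[OF q] theta3_0_minus_eq(1)[OF q] .
  moreover have "(\<lambda>n. 1 / (qprod (-1) q n * qprod 1 q n)) \<longlonglongrightarrow> 1 / (P * B)"
    by (intro tendsto_intros P B) (use P B in simp)
  ultimately have "theta3_0 (- q) * (1 / P)\<^sup>2 = 1 / (P * B)"
    by (rule LIMSEQ_unique)
  thus ?thesis
    using P B by (simp add: field_simps power2_eq_square)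
qed

section \<open>A terminating form of the four squares theorem\<close>

lemma sum_symmetric_fold:
  "(\<Sum>a\<le>2 * N. g a) = (g N :: 'a::comm_monoid_add) + (\<Sum>k<N. g (N - Suc k) + g (N + Suc k))"
proof (induction N arbitrary: g)
  case (Suc N)
  have "(\<Sum>a\<le>2 * Suc N. g a) = (\<Sum>a\<le>Suc (2 * N). g a) + g (2 * Suc N)"
    by simp
  also have "(\<Sum>a\<le>Suc (2 * N). g a) = g 0 + (\<Sum>a\<le>2 * N. g (Suc a))"
    by (rule sum.atMost_Suc_shift)
  also have "(\<Sum>a\<le>2 * N. g (Suc a)) = g (Suc N) + (\<Sum>k<N. g (Suc (N - Suc k)) + g (Suc (N + Suc k)))"
    by (rule Suc)
  also have "(\<Sum>k<N. g (Suc (N - Suc k)) + g (Suc (N + Suc k))) = (\<Sum>k<N. g (Suc N - Suc k) + g (Suc N + Suc k))"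
    by (intro sum.cong refl) (simp add: Suc_diff_Suc)
  finally show ?case
    by (simp add: add_ac mult_2)
qed simp

text \<open>
  The sum is a coefficient of \<open>K(x) = H(-x) H(x)\<close>, with \<open>H\<close> the generating function of \<open>h\<close>. The
  recurrence says \<open>(1 - x) H(x) = (1 + x) H(q x)\<close>, whence \<open>K(x) = K(q x)\<close>.
\<close>

lemma alternating_convolution_zero:
  fixes q :: complex and h :: "nat \<Rightarrow> complex"
  assumes q: "norm q < 1" and h: "\<And>m. (1 - q ^ Suc m) * h (Suc m) = (1 + q ^ m) * h m" and M: "M > 0"
  shows "(\<Sum>a\<le>M. (-1) ^ a * h a * h (M - a)) = 0"
proof -
  define H Hq K Kq where "H = Abs_fps h" and "Hq = Abs_fps (\<lambda>n. q ^ n * h n)"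
    and "K = Abs_fps (\<lambda>n. (-1) ^ n * h n)" and "Kq = Abs_fps (\<lambda>n. (-1) ^ n * (q ^ n * h n))"
  have 1: "(1 - fps_X) * H = (1 + fps_X) * Hq"
  proof (rule fps_ext)
    fix n
    show "((1 - fps_X) * H) $ n = ((1 + fps_X) * Hq) $ n"
      using h[of "n - 1"] by (cases n) (auto simp: H_def Hq_def algebra_simps)
  qed
  have 2: "(1 + fps_X) * K = (1 - fps_X) * Kq"
  proof (rule fps_ext)
    fix n
    show "((1 + fps_X) * K) $ n = ((1 - fps_X) * Kq) $ n"
    proof (cases n)
      case (Suc m)
      have "h (Suc m) - h m = q ^ Suc m * h (Suc m) + q ^ m * h m"
        using h[of m] by (simp add: algebra_simps)
      hence "(-1) ^ Suc m * (h (Suc m) - h m) = (-1) ^ Suc m * (q ^ Suc m * h (Suc m) + q ^ m * h m)"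
        by simp
      thus ?thesis by (simp add: Suc K_def Kq_def algebra_simps)
    qed (simp_all add: K_def Kq_def)
  qed
  have "((1 - fps_X) * (1 + fps_X)) * (K * H) = ((1 + fps_X) * K) * ((1 - fps_X) * H)"
    by (simp add: mult_ac)
  also have "\<dots> = ((1 - fps_X) * (1 + fps_X)) * (Kq * Hq)"
    unfolding 1 2 by (simp add: mult_ac)
  finally have "((1 - fps_X) * (1 + fps_X)) * (K * H) = ((1 - fps_X) * (1 + fps_X)) * (Kq * Hq)" .
  moreover have "(1 - fps_X) * (1 + fps_X) \<noteq> (0 :: complex fps)"
  proof
    assume "(1 - fps_X) * (1 + fps_X) = (0 :: complex fps)"
    hence "((1 - fps_X) * (1 + fps_X)) $ 0 = (0 :: complex)" by simp
    thus False by (simp add: fps_mult_nth)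
  qed
  ultimately have "(K * H) $ M = (Kq * Hq) $ M"
    by simp
  also have "\<dots> = q ^ M * (K * H) $ M"
    by (simp add: K_def H_def Kq_def Hq_def fps_mult_nth sum_distrib_left)
       (intro sum.cong refl, simp add: mult_ac flip: power_add)
  finally have "(1 - q ^ M) * (K * H) $ M = 0"
    by (simp add: algebra_simps)
  hence "(K * H) $ M = 0"
    using one_minus_power_nz[OF q M] by simp
  thus ?thesis
    by (simp add: K_def H_def fps_mult_nth atLeast0AtMost)
qed

text \<open>With u = q^N, the combination (1 + u)^2 S(N) - (1 - u)^2 S(N - 1) can be written in the
  products h(N - k) h(N + k) with weights that no longer depend on k, apart from the alternating
  sign. It is thus a multiple of an alternating convolution, which vanishes, and the two sums differ
  by the same factor as the right-hand sides.\<close>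

lemma finite_four_squares:
  assumes q: "norm q < 1"
  defines "w \<equiv> \<lambda>n. qprod 1 q n / qprod (-1) q n"
  shows "(\<Sum>k\<le>n. fold_sign k * (q ^ k / (1 + q ^ k)\<^sup>2) * (w (n - k) * w (n + k))) = (1 / w n)\<^sup>2 / 4"
proof (induction n)
  case 0
  show ?case by (simp add: fold_sign_def w_def)
next
  case (Suc n)
  define N where "N = Suc n"
  \<comment> \<open>Dividing by \<open>1 + q ^ m\<close> makes \<open>w m\<close> a polynomial
    multiple of both \<open>h m\<close> and \<open>h (Suc m)\<close>; equating the two gives the
    recurrence that the vanishing convolution requires.\<close>
  define h where "h = (\<lambda>m. w m / (1 + q ^ m))"
  define S where "S = (\<lambda>n. \<Sum>k\<le>n. fold_sign k * (q ^ k / (1 + q ^ k)\<^sup>2) * (w (n - k) * w (n + k)))"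
  define u where "u = q ^ N"
  define x y where "x = (\<lambda>j. q ^ (N - j))" and "y = (\<lambda>j. q ^ (N + j))"
  note nz = one_plus_power_nz[OF q] one_minus_power_nz[OF q]
  have w_h: "w m = h m * (1 + q ^ m)" for m
    using nz(1)[of m] by (simp add: h_def)
  have w_h': "w m = h (Suc m) * (1 - q ^ Suc m)" for m
    using nz(1)[of "Suc m"] nz(2)[of "Suc m"] by (simp add: h_def w_def qprod_Suc)
  have zero: "(\<Sum>k\<le>N. fold_sign k * (h (N - k) * h (N + k))) = 0"
  proof -
    \<comment> \<open>The alternating convolution runs over \<open>0..2 * N\<close> and is symmetric
      about \<open>N\<close>; folding it there produces the weights
      \<open>fold_sign\<close>.\<close>
    define g where "g = (\<lambda>a. (-1) ^ a * h a * h (2 * N - a))"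
    have "0 = (-1) ^ N * (\<Sum>a\<le>2 * N. g a)"
      using alternating_convolution_zero[of q h "2 * N", OF q] w_h w_h' by (simp add: g_def N_def mult_ac)
    also have "\<dots> = (-1) ^ N * g N + (\<Sum>k<N. (-1) ^ N * (g (N - Suc k) + g (N + Suc k)))"
      by (simp add: sum_symmetric_fold sum_distrib_left distrib_left)
    also have "(-1) ^ N * g N = fold_sign 0 * (h (N - 0) * h (N + 0))"
      by (simp add: g_def fold_sign_def flip: power_add)
    also have "(\<Sum>k<N. (-1) ^ N * (g (N - Suc k) + g (N + Suc k))) =
        (\<Sum>k<N. fold_sign (Suc k) * (h (N - Suc k) * h (N + Suc k)))"
    proof (intro sum.cong refl)
      fix k assume "k \<in> {..<N}"
      hence k: "Suc k \<le> N" by simp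
      have 1: "(-1 :: complex) ^ N * (-1) ^ (N + Suc k) = (-1) ^ Suc k"
        by (simp add: power_add mult.assoc[symmetric] flip: power_mult_distrib)
      have 2: "(-1 :: complex) ^ N * (-1) ^ (N - Suc k) = (-1) ^ Suc k"
        using k by (cases "even N"; cases "even (Suc k)") auto
      have "2 * N - (N - Suc k) = N + Suc k" "2 * N - (N + Suc k) = N - Suc k"
        using k by auto
      hence "(-1) ^ N * (g (N - Suc k) + g (N + Suc k)) =
         ((-1) ^ N * (-1) ^ (N - Suc k)) * (h (N - Suc k) * h (N + Suc k)) +
         ((-1) ^ N * (-1) ^ (N + Suc k)) * (h (N - Suc k) * h (N + Suc k))"
        unfolding g_def by (simp only: distrib_left mult_ac)
      thus "(-1) ^ N * (g (N - Suc k) + g (N + Suc k)) = fold_sign (Suc k) * (h (N - Suc k) * h (N + Suc k))"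
        unfolding 1 2 by (simp add: fold_sign_def)
    qed
    also have "fold_sign 0 * (h (N - 0) * h (N + 0)) + (\<Sum>k<N. fold_sign (Suc k) * (h (N - Suc k) * h (N + Suc k))) =
        (\<Sum>k\<le>N. fold_sign k * (h (N - k) * h (N + k)))"
      unfolding N_def lessThan_Suc_atMost by (rule sum.atMost_Suc_shift[symmetric])
    finally show ?thesis by simp
  qed
  have "S n = (\<Sum>k\<le>N. fold_sign k * (q ^ k / (1 + q ^ k)\<^sup>2) * ((1 - x k) * (1 - y k) * (h (N - k) * h (N + k))))"
  proof -
    have "w (n - k) * w (n + k) = (1 - x k) * (1 - y k) * (h (N - k) * h (N + k))" if "k \<le> n" for k
      using w_h'[of "n - k"] w_h'[of "n + k"] that by (simp add: N_def x_def y_def Suc_diff_le mult_ac)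
    thus ?thesis
      by (simp add: S_def N_def x_def)
  qed
  moreover have "S N = (\<Sum>k\<le>N. fold_sign k * (q ^ k / (1 + q ^ k)\<^sup>2) * ((1 + x k) * (1 + y k) * (h (N - k) * h (N + k))))"
    by (simp add: S_def w_h x_def y_def mult_ac)
  ultimately have "(1 + u)\<^sup>2 * S N - (1 - u)\<^sup>2 * S n = (\<Sum>k\<le>N. fold_sign k * (h (N - k) * h (N + k)) *
      ((q ^ k / (1 + q ^ k)\<^sup>2) * ((1 + u)\<^sup>2 * ((1 + x k) * (1 + y k)) - (1 - u)\<^sup>2 * ((1 - x k) * (1 - y k)))))"
    by (simp only: sum_distrib_left sum_subtractf[symmetric]) (intro sum.cong refl, simp only: right_diff_distrib left_diff_distrib mult_ac)
  also have "\<dots> = (\<Sum>k\<le>N. fold_sign k * (h (N - k) * h (N + k)) * (2 * u * (1 + u\<^sup>2)))"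
  proof (rule sum.cong[OF refl], rule arg_cong2[where f = "(*)", OF refl])
    fix k assume "k \<in> {..N}"
    define v where "v = q ^ k"
    \<comment> \<open>Here \<open>a\<close> stands for \<open>x k\<close>, so that
      \<open>a * v = u\<close> and \<open>a * v * v = y k\<close>. The factor
      \<open>(1 + v)\<^sup>2\<close> cancels the denominator of the summand, and what is left
      depends on \<open>u\<close> alone.\<close>
    have key: "v * ((1 + a * v)\<^sup>2 * ((1 + a) * (1 + a * v * v)) - (1 - a * v)\<^sup>2 * ((1 - a) * (1 - a * v * v))) =
        2 * (a * v) * (1 + (a * v)\<^sup>2) * (1 + v)\<^sup>2" for a
      by (simp add: power2_eq_square algebra_simps)
    have "u = x k * v" "y k = x k * v * v"
      using \<open>k \<in> {..N}\<close> by (simp_all add: u_def x_def y_def v_def flip: power_add)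
    hence "v * ((1 + u)\<^sup>2 * ((1 + x k) * (1 + y k)) - (1 - u)\<^sup>2 * ((1 - x k) * (1 - y k))) = 2 * u * (1 + u\<^sup>2) * (1 + v)\<^sup>2"
      using key[of "x k"] by simp
    thus "(q ^ k / (1 + q ^ k)\<^sup>2) * ((1 + u)\<^sup>2 * ((1 + x k) * (1 + y k)) - (1 - u)\<^sup>2 * ((1 - x k) * (1 - y k))) = 2 * u * (1 + u\<^sup>2)"
      unfolding v_def[symmetric] using nz(1)[of k] by (simp add: v_def[symmetric] field_simps)
  qed
  also have "\<dots> = 0"
    unfolding sum_distrib_right[symmetric] zero by simp
  finally have "(1 + u)\<^sup>2 * S N = (1 - u)\<^sup>2 * S n"
    by simp
  also have "S n = (1 / w n)\<^sup>2 / 4"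
    unfolding S_def by (rule Suc)
  finally have "(1 + u)\<^sup>2 * S N = (1 - u)\<^sup>2 * ((1 / w n)\<^sup>2 / 4)" .
  moreover have "(1 + u)\<^sup>2 \<noteq> 0"
    using nz(1)[of N] by (simp add: u_def)
  ultimately have "S N = (1 - u)\<^sup>2 * ((1 / w n)\<^sup>2 / 4) / (1 + u)\<^sup>2"
    by (metis nonzero_mult_div_cancel_left)
  also have "\<dots> = ((1 - u) / (1 + u) * (1 / w n))\<^sup>2 / 4"
    by (simp add: power_divide power_mult_distrib)
  also have "(1 - u) / (1 + u) * (1 / w n) = 1 / w N"
    by (simp add: u_def N_def w_def qprod_Suc mult_ac)
  finally show ?case
    by (simp add: S_def N_def)
qed

lemma summable_four_squares:
  fixes q :: complex
  assumes q: "norm q < 1"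
  shows "summable (\<lambda>k. norm (q ^ k / (1 + q ^ k)\<^sup>2))"
proof (rule summable_comparison_test_ev)
  have "(\<lambda>k. norm (1 + q ^ k)) \<longlonglongrightarrow> norm (1 + 0 :: complex)"
    by (intro tendsto_intros LIMSEQ_power_zero q)
  hence "eventually (\<lambda>k. norm (1 + q ^ k) > 1 / 2) sequentially"
    by (rule order_tendstoD) simp
  thus "eventually (\<lambda>k. norm (norm (q ^ k / (1 + q ^ k)\<^sup>2)) \<le> 4 * norm q ^ k) sequentially"
  proof eventually_elim
    case (elim k)
    have nz: "1 + q ^ k \<noteq> 0"
      by (rule one_plus_power_nz[OF q])
    have "(1 / 2) ^ 2 \<le> norm (1 + q ^ k) ^ 2"
      using elim by (intro power_mono) auto
    hence "norm q ^ k / norm (1 + q ^ k) ^ 2 \<le> norm q ^ k / (1 / 2) ^ 2"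
      using elim nz by (intro divide_left_mono) auto
    thus ?case
      by (simp add: norm_divide norm_power power_divide)
  qed
  show "summable (\<lambda>k. 4 * norm q ^ k)"
    using q by (intro summable_mult summable_geometric) simp
qed

text \<open>In the limit the terminating identity reads D (B/P)^2 = (P/B)^2 / 4, and P/B is the
  theta value. The term \<open>k = 0\<close> is 1/4, so this is Jacobi's 1 + 8 \<Sum> (-1)^k q^k /
  (1 + q^k)^2 over k \<ge> 1.\<close>

theorem four_squares_theta:
  assumes q: "norm q < 1"
  shows "theta3_0 (- q) ^ 4 = 4 * (\<Sum>k. fold_sign k * (q ^ k / (1 + q ^ k)\<^sup>2))"
proof -
  obtain P where P: "qprod (-1) q \<longlonglongrightarrow> P" "P \<noteq> 0"
    using qprod_limit[of q "-1"] q by auto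
  obtain B where B: "qprod 1 q \<longlonglongrightarrow> B" "B \<noteq> 0"
    using qprod_limit[of q 1] q by auto
  define D where "D = (\<Sum>k. fold_sign k * (q ^ k / (1 + q ^ k)\<^sup>2))"
  have w: "(\<lambda>n. qprod 1 q n / qprod (-1) q n) \<longlonglongrightarrow> B / P"
    by (intro tendsto_intros P B)
  from tendsto_convolution[OF this summable_fold_sign_mult[OF summable_four_squares[OF q]]]
  have "(\<lambda>n. (1 / (qprod 1 q n / qprod (-1) q n))\<^sup>2 / 4) \<longlonglongrightarrow> D * (B / P)\<^sup>2"
    unfolding finite_four_squares[OF q] D_def .
  moreover have "(\<lambda>n. (1 / (qprod 1 q n / qprod (-1) q n))\<^sup>2 / 4) \<longlonglongrightarrow> (1 / (B / P))\<^sup>2 / 4"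
    by (intro tendsto_intros w) (use P B in simp_all)
  ultimately have "D * (B / P)\<^sup>2 = (1 / (B / P))\<^sup>2 / 4"
    by (rule LIMSEQ_unique)
  hence "(P / B) ^ 4 = 4 * D"
    using P B by (simp add: field_simps eval_nat_numeral)
  thus ?thesis
    by (simp add: D_def theta3_0_minus_product[OF q P B])
qed

subsection \<open>The Lambert series as an elliptic function\<close>

text \<open>The denominators 1 + q^r cancel when the values of the series at z and q z are added,
  leaving a geometric series. The factor 2 makes that remainder fit (z - 1) / (z + 1), so that the
  sum of both changes sign under the shift.\<close>

definition lambert_coeff :: "complex \<Rightarrow> nat \<Rightarrow> complex" where
  "lambert_coeff q r = (if r = 0 then 0 else 2 * (-1) ^ r * q ^ r / (1 + q ^ r))"

definition lambert_fps :: "complex \<Rightarrow> nat \<Rightarrow> complex fps" where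
  "lambert_fps q n = Abs_fps (\<lambda>r. lambert_coeff q r * of_nat r ^ n)"

text \<open>
  \<open>lambert_fun q n\<close> is the \<open>n\<close>-th iterate of \<open>z * d/dz\<close> on \<open>lambert_fun q 0\<close>, so that under \<open>z = exp w\<close> it is
  the \<open>n\<close>-th derivative in \<open>w\<close>.
\<close>

definition lambert_fun :: "complex \<Rightarrow> nat \<Rightarrow> complex \<Rightarrow> complex" where
  "lambert_fun q n = eval_fps (lambert_fps q n)"

lemma lambert_fps_Suc: "lambert_fps q (Suc n) = fps_X * fps_deriv (lambert_fps q n)"
proof (rule fps_ext)
  fix r
  show "lambert_fps q (Suc n) $ r = (fps_X * fps_deriv (lambert_fps q n)) $ r"
    by (cases r) (simp_all add: lambert_fps_def)
qed

locale nome =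
  fixes q :: complex
  assumes q0: "q \<noteq> 0" and q1: "norm q < 1"
begin

lemma summable_lambert_0:
  assumes "norm (q * z) < 1"
  shows "summable (\<lambda>r. lambert_coeff q r * z ^ r)"
proof (rule summable_comparison_test')
  show "summable (\<lambda>r. 2 / (1 - norm q) * norm (q * z) ^ r)"
    using assms by (intro summable_mult summable_geometric) simp
  show "norm (lambert_coeff q r * z ^ r) \<le> 2 / (1 - norm q) * norm (q * z) ^ r" if "r \<ge> 1" for r
  proof -
    have "norm q ^ r \<le> norm q"
      using power_decreasing[of 1 r "norm q"] that q1 by simp
    moreover have "1 - norm (q ^ r) \<le> norm (1 + q ^ r)"
      using norm_diff_ineq[of 1 "q ^ r"] by simp
    ultimately have "1 - norm q \<le> norm (1 + q ^ r)"
      by (simp add: norm_power)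
    hence "2 * (norm q * norm z) ^ r / norm (1 + q ^ r) \<le> 2 * (norm q * norm z) ^ r / (1 - norm q)"
      using q1 by (intro divide_left_mono mult_pos_pos) auto
    thus ?thesis
      using that by (simp add: lambert_coeff_def norm_mult norm_divide norm_power power_mult_distrib mult_ac)
  qed
qed

lemma lambert_radius: "fps_conv_radius (lambert_fps q n) \<ge> ereal (1 / norm q)"
proof (induction n)
  case 0
  show ?case
    unfolding fps_conv_radius_def
  proof (rule conv_radius_geI_ex')
    fix r :: real assume "0 < r" "ereal r < ereal (1 / norm q)"
    hence "norm (q * of_real r) < 1"
      using q0 by (simp add: norm_mult field_simps)
    thus "summable (\<lambda>n. lambert_fps q 0 $ n * of_real r ^ n)"
      using summable_lambert_0 by (simp add: lambert_fps_def)
  qed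
next
  case (Suc n)
  also have "fps_conv_radius (lambert_fps q n) \<le> fps_conv_radius (fps_deriv (lambert_fps q n))"
    by (rule fps_conv_radius_deriv)
  also have "\<dots> \<le> fps_conv_radius (lambert_fps q (Suc n))"
    unfolding lambert_fps_Suc using fps_conv_radius_mult[of fps_X "fps_deriv (lambert_fps q n)"] by simp
  finally show ?case .
qed

lemma in_lambert_radius: "norm (q * z) < 1 \<Longrightarrow> ereal (norm z) < fps_conv_radius (lambert_fps q n)"
  by (rule less_le_trans[OF _ lambert_radius]) (use q0 in \<open>simp add: norm_mult field_simps\<close>)

lemma lambert_fun_sums:
  assumes "norm (q * z) < 1"
  shows "(\<lambda>r. lambert_coeff q r * of_nat r ^ n * z ^ r) sums lambert_fun q n z"
  using sums_eval_fps[OF in_lambert_radius[OF assms, of n]] by (simp add: lambert_fun_def lambert_fps_def)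

lemma summable_norm_lambert:
  assumes "norm (q * z) < 1"
  shows "summable (\<lambda>r. norm (lambert_coeff q r * of_nat r ^ n * z ^ r))"
  using norm_summable_fps[OF in_lambert_radius[OF assms, of n]] by (simp add: lambert_fps_def)

lemma lambert_fun_deriv:
  assumes "norm (q * z) < 1" "z \<noteq> 0"
  shows "(lambert_fun q n has_field_derivative lambert_fun q (Suc n) z / z) (at z)"
proof -
  have r: "ereal (norm z) < fps_conv_radius (lambert_fps q n)"
    by (rule in_lambert_radius[OF assms(1)])
  have "ereal (norm z) < fps_conv_radius (fps_deriv (lambert_fps q n))"
    by (rule less_le_trans[OF r fps_conv_radius_deriv])
  hence "lambert_fun q (Suc n) z = z * eval_fps (fps_deriv (lambert_fps q n)) z"
    unfolding lambert_fun_def lambert_fps_Suc by (subst eval_fps_mult) auto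
  thus ?thesis
    unfolding lambert_fun_def[of q n] using has_field_derivative_eval_fps[OF r, of UNIV] assms(2) by simp
qed

lemma norm_shift_less_1:
  assumes "norm (q * z) < 1"
  shows "norm (q * (q * z)) < 1"
proof -
  have "norm q * norm (q * z) \<le> 1 * norm (q * z)"
    using q1 by (intro mult_right_mono) auto
  thus ?thesis
    using assms by (simp add: norm_mult)
qed

lemma lambert_fun_shift_0:
  assumes "norm (q * z) < 1"
  shows "lambert_fun q 0 z + lambert_fun q 0 (q * z) = - 2 * (q * z) / (1 + q * z)"
proof -
  have qz: "norm (q * (q * z)) < 1"
    by (rule norm_shift_less_1[OF assms])
  have "(\<lambda>r. lambert_coeff q r * z ^ r + lambert_coeff q r * (q * z) ^ r) sums (lambert_fun q 0 z + lambert_fun q 0 (q * z))"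
    using lambert_fun_sums[OF assms, of 0] lambert_fun_sums[OF qz, of 0] by (auto intro: sums_add)
  moreover have "lambert_coeff q r * z ^ r + lambert_coeff q r * (q * z) ^ r = (if r = 0 then 0 else 2 * (- (q * z)) ^ r)" for r
  proof (cases "r = 0")
    case False
    have "lambert_coeff q r * (1 + q ^ r) = 2 * (-1) ^ r * q ^ r"
      using False one_plus_power_nz[OF q1, of r] by (simp add: lambert_coeff_def)
    hence "lambert_coeff q r * (1 + q ^ r) * z ^ r = 2 * (-1) ^ r * q ^ r * z ^ r"
      by simp
    thus ?thesis
      using False by (subst power_minus) (simp add: power_mult_distrib algebra_simps)
  qed (simp add: lambert_coeff_def)
  moreover have "(\<lambda>r. if r = 0 then 0 else 2 * (- (q * z)) ^ r) sums (- 2 * (q * z) / (1 + q * z))"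
  proof -
    have "(\<lambda>r. 2 * (- (q * z)) * (- (q * z)) ^ r) sums (2 * (- (q * z)) * (1 / (1 - (- (q * z)))))"
      using assms by (intro sums_mult geometric_sums) simp
    hence "(\<lambda>r. if Suc r = 0 then 0 else 2 * (- (q * z)) ^ Suc r) sums (- 2 * (q * z) / (1 + q * z))"
      by (simp add: mult_ac)
    thus ?thesis
      by (subst (asm) sums_Suc_iff) simp
  qed
  ultimately show ?thesis
    using sums_unique2 by (simp only:) blast
qed

lemma lambert_fun_shift_1:
  assumes "norm (q * z) < 1"
  shows "lambert_fun q 1 z + lambert_fun q 1 (q * z) = - 2 * (q * z) / (1 + q * z)\<^sup>2"
proof -
  have qz: "norm (q * (q * z)) < 1"
    by (rule norm_shift_less_1[OF assms])
  have "(\<lambda>r. lambert_coeff q r * of_nat r * z ^ r + lambert_coeff q r * of_nat r * (q * z) ^ r) sums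
      (lambert_fun q 1 z + lambert_fun q 1 (q * z))"
    using lambert_fun_sums[OF assms, of 1] lambert_fun_sums[OF qz, of 1] by (auto intro: sums_add)
  moreover have "lambert_coeff q r * of_nat r * z ^ r + lambert_coeff q r * of_nat r * (q * z) ^ r =
      2 * of_nat r * (- (q * z)) ^ r" for r
  proof (cases "r = 0")
    case False
    have "lambert_coeff q r * (1 + q ^ r) = 2 * (-1) ^ r * q ^ r"
      using False one_plus_power_nz[OF q1, of r] by (simp add: lambert_coeff_def)
    hence "lambert_coeff q r * (1 + q ^ r) * (of_nat r * z ^ r) = 2 * (-1) ^ r * q ^ r * (of_nat r * z ^ r)"
      by simp
    thus ?thesis
      by (subst power_minus) (simp add: power_mult_distrib algebra_simps)
  qed (simp add: lambert_coeff_def)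
  moreover have "(\<lambda>r. 2 * of_nat r * (- (q * z)) ^ r) sums (- 2 * (q * z) / (1 + q * z)\<^sup>2)"
  proof -
    have "(\<lambda>r. 2 * (- (q * z)) * (of_nat (Suc r) * (- (q * z)) ^ r)) sums (2 * (- (q * z)) * (1 / (1 - (- (q * z)))\<^sup>2))"
      using assms by (intro sums_mult geometric_deriv_sums) simp
    moreover have "2 * (- (q * z)) * (of_nat (Suc r) * (- (q * z)) ^ r) = 2 * of_nat (Suc r) * (- (q * z)) ^ Suc r" for r
      by (simp only: power_Suc mult_ac)
    moreover have "2 * (- (q * z)) * (1 / (1 - (- (q * z)))\<^sup>2) = - 2 * (q * z) / (1 + q * z)\<^sup>2"
      by simp
    ultimately have "(\<lambda>r. 2 * of_nat (Suc r) * (- (q * z)) ^ Suc r) sums (- 2 * (q * z) / (1 + q * z)\<^sup>2)"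
      by (simp only:)
    thus ?thesis
      by (subst (asm) sums_Suc_iff) simp
  qed
  ultimately show ?thesis
    using sums_unique2 by (simp only:) blast
qed

lemma lambertU_eq:
  assumes "k > 0"
  shows "lambert_fun q k 1 = - 2 * lambertU k q"
proof -
  have qn: "norm (q * 1) < 1" using q1 by simp
  define f where "f = (\<lambda>r. (-1) ^ (r - 1) * (of_nat r ^ k * q ^ r / (1 + q ^ r)))"
  \<comment> \<open>At \<open>r = 0\<close> the exponent \<open>r - 1\<close> is truncated, but
    \<open>of_nat r ^ k\<close> vanishes there since \<open>k > 0\<close>.\<close>
  have eq: "lambert_coeff q r * of_nat r ^ k * 1 ^ r = - 2 * f r" for r
    using assms by (cases r) (simp_all add: lambert_coeff_def f_def)
  have "((\<lambda>r. - 2 * f r) has_sum lambert_fun q k 1) UNIV"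
    using norm_summable_imp_has_sum[OF summable_norm_lambert[OF qn] lambert_fun_sums[OF qn], of k] unfolding eq .
  hence "((\<lambda>r. (-1/2) * (- 2 * f r)) has_sum ((-1/2) * lambert_fun q k 1)) UNIV"
    by (rule has_sum_cmult_right)
  hence "(f has_sum ((-1/2) * lambert_fun q k 1)) UNIV"
    by simp
  hence "infsum f UNIV = (-1/2) * lambert_fun q k 1"
    by (rule infsumI)
  moreover have "infsum f UNIV = infsum f {1..}"
    using assms by (intro infsum_cong_neutral) (auto simp: f_def not_le)
  moreover have "lambertU k q = infsum f {1..}"
    by (simp only: lambertU_def f_def)
  ultimately show ?thesis
    by simp
qed

text \<open>Iterating the shift relation along 1, q, q^2, ... trades the series in r q^r / (1 + q^r)
  for the one with squared denominators that occurs in the four squares theorem. The remainder tends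
  to 0 by continuity at 0.\<close>

lemma lambert_fun_1_at_1:
  "(\<lambda>k. (-1) ^ k * (2 * q ^ Suc k / (1 + q ^ Suc k)\<^sup>2)) sums (- lambert_fun q 1 1)"
proof -
  define t where "t = (\<lambda>k. (-1) ^ k * (2 * q ^ Suc k / (1 + q ^ Suc k)\<^sup>2))"
  have partial: "- lambert_fun q 1 1 = (\<Sum>k<m. t k) - (-1) ^ m * lambert_fun q 1 (q ^ m)" for m
  proof (induction m)
    case (Suc m)
    have "norm (q * q ^ m) < 1"
      using norm_power_less_1[OF q1, of "Suc m"] by simp
    from lambert_fun_shift_1[OF this]
    have "lambert_fun q 1 (q ^ m) = - 2 * q ^ Suc m / (1 + q ^ Suc m)\<^sup>2 - lambert_fun q 1 (q ^ Suc m)"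
      by (simp only: power_Suc eq_diff_eq)
    thus ?case
      unfolding Suc by (simp only:) (simp add: t_def algebra_simps)
  qed simp
  have "isCont (lambert_fun q 1) 0"
    unfolding lambert_fun_def
    using has_field_derivative_eval_fps[OF in_lambert_radius[of 0], of 1 UNIV] DERIV_isCont by auto
  hence "(\<lambda>m. lambert_fun q 1 (q ^ m)) \<longlonglongrightarrow> lambert_fun q 1 0"
    by (rule isCont_tendsto_compose) (intro LIMSEQ_power_zero q1)
  also have "lambert_fun q 1 0 = 0"
    by (simp add: lambert_fun_def eval_fps_at_0 lambert_fps_def)
  finally have "(\<lambda>m. (-1) ^ m * lambert_fun q 1 (q ^ m)) \<longlonglongrightarrow> 0"
    by (subst tendsto_norm_zero_iff[symmetric]) (simp add: norm_mult norm_power tendsto_norm_zero)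
  hence "(\<lambda>m. - lambert_fun q 1 1 + (-1) ^ m * lambert_fun q 1 (q ^ m)) \<longlonglongrightarrow> - lambert_fun q 1 1 + 0"
    by (intro tendsto_intros)
  moreover have "- lambert_fun q 1 1 + (-1) ^ m * lambert_fun q 1 (q ^ m) = (\<Sum>k<m. t k)" for m
    using partial[of m] by simp
  ultimately show ?thesis
    by (simp add: sums_def t_def)
qed

lemma theta3_0_power4: "theta3_0 (- q) ^ 4 = 1 + 4 * lambert_fun q 1 1"
proof -
  define d where "d = (\<lambda>k. fold_sign k * (q ^ k / (1 + q ^ k)\<^sup>2))"
  have sd: "summable d"
    unfolding d_def by (rule summable_norm_cancel[OF summable_fold_sign_mult[OF summable_four_squares[OF q1]]])
  have "(\<lambda>k. - ((-1) ^ k * (2 * q ^ Suc k / (1 + q ^ Suc k)\<^sup>2))) sums (- (- lambert_fun q 1 1))"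
    by (intro sums_minus lambert_fun_1_at_1)
  moreover have "- ((-1) ^ k * (2 * q ^ Suc k / (1 + q ^ Suc k)\<^sup>2)) = d (Suc k)" for k
    by (simp add: d_def fold_sign_def)
  ultimately have tail: "(\<Sum>k. d (Suc k)) = lambert_fun q 1 1"
    by (simp add: sums_iff)
  have "suminf d = d 0 + (\<Sum>k. d (Suc k))"
    using suminf_split_head[OF sd] by simp
  also have "d 0 = 1 / 4"
    by (simp add: d_def fold_sign_def)
  finally have "suminf d = 1 / 4 + lambert_fun q 1 1"
    unfolding tail .
  thus ?thesis
    unfolding four_squares_theta[OF q1] d_def by simp
qed

section \<open>Antiperiodic functions on an annulus and the differential equation\<close>

definition annulus :: "complex set" where
  "annulus = {z. norm q < norm z \<and> norm z < 1 / norm q}"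

text \<open>Exactly the points \<open>z\<close> for which \<open>z\<close> and \<open>q * z\<close>
  both lie in \<open>annulus\<close>, hence the domain of the shift relations.\<close>

definition outer :: "complex set" where
  "outer = {z. 1 < norm z \<and> norm z < 1 / norm q}"

lemma annulus_nz: "z \<in> annulus \<Longrightarrow> z \<noteq> 0"
  by (auto simp: annulus_def)

lemma annulus_norm_less_1: "z \<in> annulus \<Longrightarrow> norm (q * z) < 1" "z \<in> annulus \<Longrightarrow> norm (q * (1 / z)) < 1"
proof -
  assume "z \<in> annulus"
  hence "norm q < norm z" "norm z < 1 / norm q"
    by (auto simp: annulus_def)
  moreover from this(1) have "norm z > 0"
    by (rule le_less_trans[OF norm_ge_zero])
  ultimately show "norm (q * z) < 1" "norm (q * (1 / z)) < 1"
    using q0 by (simp_all add: norm_mult norm_divide field_simps)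
qed

lemma open_annulus: "open annulus"
  unfolding annulus_def by (intro open_Collect_conj open_Collect_less continuous_intros)

lemma open_outer: "open outer"
  unfolding outer_def by (intro open_Collect_conj open_Collect_less continuous_intros)

lemma connected_annulus_q: "connected annulus"
  using connected_annulus(1)[of "norm q" "0 :: complex" "1 / norm q"] by (simp add: annulus_def)

lemma outer_in_annulus: "z \<in> outer \<Longrightarrow> z \<in> annulus" "z \<in> outer \<Longrightarrow> q * z \<in> annulus"
  "z \<in> outer \<Longrightarrow> z \<noteq> - 1" "z \<in> outer \<Longrightarrow> q * z \<noteq> - 1"
proof -
  assume z: "z \<in> outer"
  have qz: "norm (q * z) < 1"
    using z q0 by (auto simp: outer_def norm_mult field_simps)
  have "norm q < norm (q * z)"
    using z q0 by (simp add: outer_def norm_mult)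
  moreover have "1 < 1 / norm q"
    using q0 q1 by simp
  ultimately show "z \<in> annulus" "q * z \<in> annulus"
    using z qz q1 by (auto simp: outer_def annulus_def)
  show "z \<noteq> - 1" "q * z \<noteq> - 1"
    using z qz by (auto simp: outer_def)
qed

text \<open>
  Every value of \<open>W\<close> occurs, up to sign, on a compact annulus strictly inside, so by the maximum
  modulus principle \<open>W\<close> is constant.
\<close>

lemma annulus_antiperiodic_zero:
  assumes hol: "W holomorphic_on annulus" and anti: "\<And>z. z \<in> outer \<Longrightarrow> W (q * z) = - W z" and z: "z \<in> annulus"
  shows "W z = 0"
proof -
  \<comment> \<open>The radii \<rho> and 1 / \<rho> have ratio |q|, so the closed annulus
    \<open>K\<close> between them is a fundamental domain: a point of \<open>annulus\<close> outside
    \<open>K\<close> enters it after one multiplication or division by \<open>q\<close>.\<close>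
  define \<rho> where "\<rho> = sqrt (norm q)"
  have \<rho>: "0 < \<rho>" "\<rho> < 1" "norm q = \<rho> * \<rho>"
    using q0 q1 by (auto simp: \<rho>_def)
  define K :: "complex set" where "K = cball 0 (1 / \<rho>) - ball 0 \<rho>"
  have K: "z \<in> K \<longleftrightarrow> \<rho> \<le> norm z \<and> norm z \<le> 1 / \<rho>" for z
    by (auto simp: K_def)
  have less: "\<rho> * \<rho> < \<rho>" "\<rho> < 1 / \<rho>" "1 < 1 / \<rho>" "1 / \<rho> < 1 / (\<rho> * \<rho>)"
    using \<rho> by (auto simp: field_simps intro: mult_strict_mono[of \<rho> 1 \<rho> 1, simplified])
  have "compact K"
    unfolding K_def by (intro compact_diff) auto
  moreover have "1 \<in> K"
    using \<rho> less by (auto simp: K)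
  hence "K \<noteq> {}" by blast
  moreover have KA: "K \<subseteq> annulus"
  proof
    fix z assume "z \<in> K"
    hence "\<rho> * \<rho> < norm z" "norm z < 1 / (\<rho> * \<rho>)"
      using less unfolding K by linarith+
    thus "z \<in> annulus"
      by (simp add: annulus_def \<rho>(3))
  qed
  hence "continuous_on K (\<lambda>z. norm (W z))"
    by (intro continuous_on_norm) (meson hol holomorphic_on_imp_continuous_on continuous_on_subset)
  ultimately obtain z0 where z0: "z0 \<in> K" "\<And>z. z \<in> K \<Longrightarrow> norm (W z) \<le> norm (W z0)"
    using continuous_attains_sup by meson
  have bound: "norm (W z) \<le> norm (W z0)" if "z \<in> annulus" for z
  proof -
    consider "z \<in> K" | "norm z > 1 / \<rho>" | "norm z < \<rho>"
      using K not_le by blast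
    thus ?thesis
    proof cases
      case 2
      have "z \<in> outer"
        using 2 less that by (auto simp: outer_def annulus_def)
      moreover have "q * z \<in> K"
      proof -
        have "\<rho> * (\<rho> * norm z) \<ge> \<rho> * 1"
          using 2 \<rho> by (intro mult_left_mono) (auto simp: field_simps)
        hence "\<rho> \<le> norm (q * z)"
          by (simp add: norm_mult \<rho>(3) mult.assoc)
        moreover have "norm (q * z) < 1"
          by (rule annulus_norm_less_1[OF that])
        ultimately show ?thesis
          using less(3) unfolding K by linarith
      qed
      ultimately show ?thesis
        using z0(2)[of "q * z"] anti[of z] by simp
    next
      case 3
      have qz: "q * (z / q) = z"
        using q0 by simp
      have n: "norm (z / q) = norm z / (\<rho> * \<rho>)"
        by (simp add: norm_divide \<rho>)
      have "1 < norm (z / q)"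
        using that \<rho> unfolding n by (simp add: annulus_def)
      moreover have "norm (z / q) < 1 / \<rho>"
        using 3 \<rho> unfolding n by (simp add: field_simps)
      ultimately have "z / q \<in> outer" "z / q \<in> K"
        using less \<rho>(2) unfolding K outer_def mem_Collect_eq \<rho>(3) by linarith+
      thus ?thesis
        using z0(2)[of "z / q"] anti[of "z / q"] unfolding qz by simp
    qed (rule z0)
  qed
  have "W constant_on annulus"
    by (rule maximum_modulus_principle[OF hol open_annulus connected_annulus_q open_annulus order_refl])
       (use z0 KA bound in auto)
  then obtain c where c: "\<And>z. z \<in> annulus \<Longrightarrow> W z = c"
    by (auto simp: constant_on_def)
  have "complex_of_real (1 / \<rho>) \<in> outer"
    using \<rho> less by (simp add: outer_def norm_divide)
  from anti[OF this] c outer_in_annulus(1,2)[OF this] have "c = - c"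
    by metis
  thus ?thesis
    using c[OF z] by simp
qed

text \<open>Odd under z -> 1/z at index 0, so that a function odd in w results. Each application of
  \<open>z * d/dz\<close> to a function of 1/z brings a minus sign, whence
  \<open>(-1) ^ n\<close>.\<close>

definition lambert_symm :: "nat \<Rightarrow> complex \<Rightarrow> complex" where
  "lambert_symm n z = lambert_fun q n z - (-1) ^ n * lambert_fun q n (1 / z)"

lemma lambert_symm_deriv:
  assumes "z \<in> annulus"
  shows "(lambert_symm n has_field_derivative lambert_symm (Suc n) z / z) (at z)"
proof -
  note nz = annulus_nz[OF assms]
  have 1: "(lambert_fun q n has_field_derivative lambert_fun q (Suc n) z / z) (at z)"
    by (rule lambert_fun_deriv[OF annulus_norm_less_1(1)[OF assms] nz])
  have inv: "((\<lambda>z. 1 / z) has_field_derivative - (1 / z\<^sup>2)) (at z)"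
    using nz by (auto intro!: derivative_eq_intros simp: power2_eq_square)
  have "(lambert_fun q n has_field_derivative lambert_fun q (Suc n) (1 / z) / (1 / z)) (at (1 / z))"
    by (rule lambert_fun_deriv[OF annulus_norm_less_1(2)[OF assms]]) (use nz in simp)
  from DERIV_chain2[OF this inv]
  have 2: "((\<lambda>z. lambert_fun q n (1 / z)) has_field_derivative - (lambert_fun q (Suc n) (1 / z) / z)) (at z)"
    using nz by (simp add: power2_eq_square)
  show ?thesis
    unfolding lambert_symm_def[abs_def] using DERIV_diff[OF 1 DERIV_cmult[OF 2, of "(-1) ^ n"]]
    by (simp add: diff_divide_distrib add_divide_distrib)
qed

lemma lambert_symm_holomorphic: "lambert_symm n holomorphic_on annulus"
  using lambert_symm_deriv by (auto simp: holomorphic_on_open[OF open_annulus])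

lemma lambert_symm_0_minus_1: "lambert_symm 0 (-1) = 0"
  by (simp add: lambert_symm_def)

text \<open>
  The index \<open>n\<close> counts applications of \<open>z * d/dz\<close>; the first summand is \<open>tanh (w / 2)\<close> at \<open>z = exp w\<close>.
\<close>

definition elliptic_fun :: "nat \<Rightarrow> complex \<Rightarrow> complex" where
  "elliptic_fun n z = (if n = 0 then (z - 1) / (z + 1) else if n = 1 then 2 * z / (z + 1)\<^sup>2 else 2 * z * (1 - z) / (z + 1) ^ 3) + lambert_symm n z"

lemma plus_1_nz: "z + 1 \<noteq> 0" if "z \<noteq> - 1" for z :: complex
  using that by (simp add: eq_neg_iff_add_eq_0)

lemma elliptic_fun_deriv:
  assumes "z \<in> annulus" "z \<noteq> - 1" "n < 2"
  shows "(elliptic_fun n has_field_derivative elliptic_fun (Suc n) z / z) (at z)"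
proof -
  note nz = annulus_nz[OF assms(1)] plus_1_nz[OF assms(2)]
  have 0: "((\<lambda>z. (z - 1) / (z + 1)) has_field_derivative (2 * z / (z + 1)\<^sup>2) / z) (at z)"
    using nz by (auto intro!: derivative_eq_intros simp: divide_simps power2_eq_square)
  have 1: "((\<lambda>z. 2 * z / (z + 1)\<^sup>2) has_field_derivative (2 * z * (1 - z) / (z + 1) ^ 3) / z) (at z)"
  proof -
    have "((\<lambda>z. 2 * z / (z + 1)\<^sup>2) has_field_derivative
        (2 * (z + 1)\<^sup>2 - 2 * z * (2 * (z + 1))) / ((z + 1)\<^sup>2 * (z + 1)\<^sup>2)) (at z)"
      using nz by (auto intro!: derivative_eq_intros)
    moreover have "(2 * (z + 1)\<^sup>2 - 2 * z * (2 * (z + 1))) / ((z + 1)\<^sup>2 * (z + 1)\<^sup>2) = (2 * z * (1 - z) / (z + 1) ^ 3) / z"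
    proof -
      define y where "y = z + 1"
      have "2 * y\<^sup>2 - 2 * z * (2 * y) = y * (2 * (1 - z))"
        by (simp add: y_def power2_eq_square algebra_simps)
      hence "(2 * y\<^sup>2 - 2 * z * (2 * y)) / (y\<^sup>2 * y\<^sup>2) = 2 * (1 - z) / y ^ 3"
        using nz by (simp add: y_def[symmetric] power2_eq_square power3_eq_cube)
      thus ?thesis
        using nz by (simp add: y_def)
    qed
    ultimately show ?thesis by simp
  qed
  from assms(3) consider "n = 0" | "n = 1" by linarith
  thus ?thesis
  proof cases
    case 1
    show ?thesis
      unfolding elliptic_fun_def[abs_def] 1 using DERIV_add[OF 0 lambert_symm_deriv[OF assms(1), of 0]] by (simp add: add_divide_distrib)
  next
    case 2
    show ?thesis
      unfolding elliptic_fun_def[abs_def] 2 using DERIV_add[OF 1 lambert_symm_deriv[OF assms(1), of 1]]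
      by (simp add: add_divide_distrib)
  qed
qed

text \<open>The shift relation of the series is used at z and at 1 / (q z). Its two rational
  remainders turn the tanh terms at q z and at z into - 1 and 1, which cancel.\<close>

lemma elliptic_fun_0_shift:
  assumes "z \<in> outer"
  shows "elliptic_fun 0 (q * z) = - elliptic_fun 0 z"
proof -
  note z = outer_in_annulus[OF assms]
  note nz = annulus_nz[OF z(1)] plus_1_nz[OF z(3)] plus_1_nz[OF z(4)]
  have 1: "lambert_fun q 0 z + lambert_fun q 0 (q * z) = - 2 * (q * z) / (1 + q * z)"
    by (rule lambert_fun_shift_0[OF annulus_norm_less_1(1)[OF z(1)]])
  have e: "q * (1 / (q * z)) = 1 / z"
    using q0 by simp
  have "norm (q * (1 / (q * z))) < 1"
    unfolding e using assms by (simp add: outer_def norm_divide divide_less_eq)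
  from lambert_fun_shift_0[OF this]
  have "lambert_fun q 0 (1 / (q * z)) + lambert_fun q 0 (1 / z) = - 2 * (1 / z) / (1 + 1 / z)"
    unfolding e .
  also have "\<dots> = - 2 / (z + 1)"
    using nz by (simp add: field_simps)
  finally have 2: "lambert_fun q 0 (1 / (q * z)) + lambert_fun q 0 (1 / z) = - 2 / (z + 1)" .
  have "elliptic_fun 0 (q * z) + elliptic_fun 0 z = (q * z - 1) / (q * z + 1) + (z - 1) / (z + 1) +
      (lambert_fun q 0 z + lambert_fun q 0 (q * z)) - (lambert_fun q 0 (1 / (q * z)) + lambert_fun q 0 (1 / z))"
    by (simp add: elliptic_fun_def lambert_symm_def)
  also have "\<dots> = ((q * z - 1) / (q * z + 1) - 2 * (q * z) / (q * z + 1)) + ((z - 1) / (z + 1) + 2 / (z + 1))"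
    unfolding 1 2 by (simp add: add.commute)
  also have "(q * z - 1) / (q * z + 1) - 2 * (q * z) / (q * z + 1) = - 1"
    using nz(3) by (subst diff_divide_distrib[symmetric], subst divide_eq_eq) simp
  also have "(z - 1) / (z + 1) + 2 / (z + 1) = 1"
    using nz(2) by (subst add_divide_distrib[symmetric], subst divide_eq_eq) simp
  finally show ?thesis
    by (simp add: eq_neg_iff_add_eq_0)
qed

text \<open>The operator \<open>z * d/dz\<close> commutes with z -> q z, so the sign change passes
  to the derivatives.\<close>

lemma elliptic_fun_shift:
  assumes "z \<in> outer" "n \<le> 2"
  shows "elliptic_fun n (q * z) = - elliptic_fun n z"
  using assms
proof (induction n arbitrary: z)
  case 0
  thus ?case by (intro elliptic_fun_0_shift)
next
  case (Suc n)
  note z = outer_in_annulus[OF Suc.prems(1)]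
  have "((\<lambda>z. elliptic_fun n (q * z)) has_field_derivative elliptic_fun (Suc n) (q * z) / (q * z) * q) (at z)"
    using Suc.prems by (intro DERIV_chain2[where f = "elliptic_fun n" and g = "\<lambda>z. q * z", OF elliptic_fun_deriv[OF z(2,4)]]) (auto intro!: derivative_eq_intros)
  moreover have "((\<lambda>z. elliptic_fun n (q * z)) has_field_derivative - (elliptic_fun (Suc n) z / z)) (at z)"
  proof (rule has_field_derivative_transform_within_open[OF _ open_outer Suc.prems(1)])
    show "((\<lambda>z. - elliptic_fun n z) has_field_derivative - (elliptic_fun (Suc n) z / z)) (at z)"
      using Suc.prems by (intro DERIV_minus elliptic_fun_deriv[OF z(1,3)]) auto
    show "- elliptic_fun n z = elliptic_fun n (q * z)" if "z \<in> outer" for z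
      using Suc.IH[OF that] Suc.prems by simp
  qed
  ultimately have "elliptic_fun (Suc n) (q * z) / (q * z) * q = - (elliptic_fun (Suc n) z / z)"
    by (rule DERIV_unique)
  thus ?case
    using q0 annulus_nz[OF z(1)] by (simp add: field_simps)
qed

text \<open>
  On \<open>annulus\<close> the only pole is at \<open>- 1\<close>, that of \<open>T = (z - 1) / (z + 1)\<close>. As \<open>lambert_symm 0\<close> vanishes there,
  \<open>k\<close> extends \<open>T * lambert_symm 0\<close> and \<open>l\<close> extends \<open>T * (k - k (- 1))\<close>; the choice of \<open>\<beta>\<close> removes the remaining
  simple pole.
\<close>

lemma elliptic_fun_ode: "\<exists>\<beta>. \<forall>z \<in> annulus - {- 1}. elliptic_fun 2 z = \<beta> * elliptic_fun 0 z + (1 / 2) * elliptic_fun 0 z ^ 3"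
proof -
  define k where "k = (\<lambda>z. (z - 1) * (if z = - 1 then deriv (lambert_symm 0) (- 1) else (lambert_symm 0 z - lambert_symm 0 (- 1)) / (z - (- 1))))"
  define l where "l = (\<lambda>z. (z - 1) * (if z = - 1 then deriv k (- 1) else (k z - k (- 1)) / (z - (- 1))))"
  \<comment> \<open>The \<open>- 1 / 2\<close> belongs to the equation of tanh. With s for
    \<open>lambert_symm 0\<close>, the cubic produces 3/2 T^2 s = 3/2 (l + k(-1) T), and \<beta>
    absorbs the term in \<open>T\<close>.\<close>
  define \<beta> where "\<beta> = - 1 / 2 - 3 / 2 * k (- 1)"
  define W where "W = (\<lambda>z. lambert_symm 2 z - \<beta> * lambert_symm 0 z - lambert_symm 0 z ^ 3 / 2 - 3 / 2 * l z - 3 / 2 * k z * lambert_symm 0 z)"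
  have "k holomorphic_on annulus"
    unfolding k_def by (intro holomorphic_intros pole_lemma_open lambert_symm_holomorphic open_annulus)
  moreover from this have "l holomorphic_on annulus"
    unfolding l_def by (intro holomorphic_intros pole_lemma_open open_annulus)
  ultimately have hol: "W holomorphic_on annulus"
    unfolding W_def by (intro holomorphic_intros lambert_symm_holomorphic) auto
  have W: "W z = elliptic_fun 2 z - \<beta> * elliptic_fun 0 z - elliptic_fun 0 z ^ 3 / 2" if "z \<noteq> - 1" for z
  proof -
    note nz = plus_1_nz[OF that]
    define T where "T = (z - 1) / (z + 1)"
    have k: "k z = T * lambert_symm 0 z"
      using that by (simp add: k_def T_def lambert_symm_0_minus_1)
    have l: "l z = T * (T * lambert_symm 0 z - k (- 1))"
    proof -
      have "l z = (z - 1) * ((k z - k (- 1)) / (z + 1))"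
        using that by (simp add: l_def)
      thus ?thesis
        unfolding k by (simp add: T_def)
    qed
    have "(1 - T\<^sup>2) * (z + 1)\<^sup>2 = (z + 1)\<^sup>2 - (T * (z + 1))\<^sup>2"
      by (simp add: algebra_simps power2_eq_square)
    also have "T * (z + 1) = z - 1"
      using nz by (simp add: T_def)
    also have "(z + 1)\<^sup>2 - (z - 1)\<^sup>2 = 4 * z"
      by (simp add: algebra_simps power2_eq_square)
    finally have "1 - T\<^sup>2 = 4 * z / (z + 1)\<^sup>2"
      using nz by (simp add: field_simps)
    moreover have "2 * z * (1 - z) / (z + 1) ^ 3 = - (T / 2 * (4 * z / (z + 1)\<^sup>2))"
    proof -
      have "2 * z * (1 - z) / y ^ 3 = - ((z - 1) / y / 2 * (4 * z / y\<^sup>2))" if "y \<noteq> 0" for y :: complex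
        using that by (simp add: field_simps power2_eq_square power3_eq_cube)
      from this[OF nz] show ?thesis
        unfolding T_def .
    qed
    ultimately have "2 * z * (1 - z) / (z + 1) ^ 3 = - (T / 2 * (1 - T\<^sup>2))"
      by simp
    hence expand: "elliptic_fun 2 z = - (T / 2 * (1 - T\<^sup>2)) + lambert_symm 2 z" "elliptic_fun 0 z = T + lambert_symm 0 z"
      by (simp_all add: elliptic_fun_def T_def)
    show ?thesis
      unfolding W_def expand k l \<beta>_def by (simp add: field_simps power2_eq_square power3_eq_cube)
  qed
  \<comment> \<open>Every term of the equation is odd in \<open>elliptic_fun\<close>, so the sign
    change carries over; for \<open>z\<close> in \<open>outer\<close> neither \<open>z\<close> nor
    \<open>q * z\<close> is the exceptional point.\<close>
  have "W (q * z) = - W z" if "z \<in> outer" for z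
    using outer_in_annulus(3,4)[OF that] that by (simp add: W elliptic_fun_shift power3_eq_cube)
  with annulus_antiperiodic_zero[OF hol] have zero: "W z = 0" if "z \<in> annulus" for z
    using that by blast
  have "elliptic_fun 2 z = \<beta> * elliptic_fun 0 z + (1 / 2) * elliptic_fun 0 z ^ 3" if "z \<in> annulus - {- 1}" for z
    using zero[of z] W[of z] that by (simp add: eq_diff_eq add.commute)
  thus ?thesis by blast
qed

section \<open>Taylor coefficients of the elliptic function at \<open>w = 0\<close>\<close>

definition elliptic_fps :: "complex fps" where
  "elliptic_fps = fps_tanh_half + Abs_fps (\<lambda>n. lambert_symm n 1 / fact n)"

lemma one_in_annulus: "1 \<in> annulus"
  using q0 q1 by (simp add: annulus_def)

lemma has_fps_expansion_elliptic_fun: "(\<lambda>w. elliptic_fun 0 (exp w)) has_fps_expansion elliptic_fps"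
proof -
  define S :: "complex set" where "S = exp -` annulus"
  have S: "open S" "0 \<in> S"
    unfolding S_def by (intro open_vimage open_annulus continuous_intros) (simp add: one_in_annulus)
  have deriv: "((\<lambda>w. lambert_symm n (exp w)) has_field_derivative lambert_symm (Suc n) (exp w)) (at w)" if "w \<in> S" for n w
    using DERIV_chain2[OF lambert_symm_deriv DERIV_exp, of w n] that by (simp add: S_def)
  have "((deriv ^^ n) (\<lambda>w. lambert_symm 0 (exp w))) w = lambert_symm n (exp w)" if "w \<in> S" for n w
    using that
  proof (induction n arbitrary: w)
    case (Suc n)
    have "((deriv ^^ n) (\<lambda>w. lambert_symm 0 (exp w)) has_field_derivative lambert_symm (Suc n) (exp w)) (at w)"
      by (rule has_field_derivative_transform_within_open[OF deriv[OF Suc.prems] S(1) Suc.prems]) (simp add: Suc.IH)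
    thus ?case
      by (simp add: DERIV_imp_deriv)
  qed simp
  hence "fps_expansion (\<lambda>w. lambert_symm 0 (exp w)) 0 = Abs_fps (\<lambda>n. lambert_symm n 1 / fact n)"
    using S(2) by (simp add: fps_expansion_def)
  moreover have "(\<lambda>w. lambert_symm 0 (exp w)) holomorphic_on S"
    using deriv[of _ 0] by (auto simp: holomorphic_on_open[OF S(1)])
  ultimately have "(\<lambda>w. lambert_symm 0 (exp w)) has_fps_expansion Abs_fps (\<lambda>n. lambert_symm n 1 / fact n)"
    using has_fps_expansion_fps_expansion[OF S] by metis
  moreover have "(\<lambda>w. (exp w - 1) * inverse (exp w + 1) :: complex) has_fps_expansion fps_tanh_half"
    unfolding fps_tanh_half_def by (intro fps_expansion_intros) simp
  ultimately have "(\<lambda>w. (exp w - 1) * inverse (exp w + 1) + lambert_symm 0 (exp w)) has_fps_expansion elliptic_fps"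
    unfolding elliptic_fps_def by (rule has_fps_expansion_add[rotated])
  thus ?thesis
    by (simp add: elliptic_fun_def divide_inverse)
qed

lemma elliptic_fps_ode:
  "\<exists>\<beta>. fps_deriv (fps_deriv elliptic_fps) = fps_const \<beta> * elliptic_fps + fps_const (1 / 2) * elliptic_fps ^ 3"
proof -
  obtain \<beta> where \<beta>: "\<And>z. z \<in> annulus - {- 1} \<Longrightarrow> elliptic_fun 2 z = \<beta> * elliptic_fun 0 z + (1 / 2) * elliptic_fun 0 z ^ 3"
    using elliptic_fun_ode by blast
  define S :: "complex set" where "S = exp -` (annulus - {- 1})"
  have S: "open S" "0 \<in> S"
    unfolding S_def by (intro open_vimage open_delete open_annulus continuous_intros) (simp add: one_in_annulus)
  have d: "((\<lambda>w. elliptic_fun n (exp w)) has_field_derivative elliptic_fun (Suc n) (exp w)) (at w)" if "w \<in> S" "n < 2" for n w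
    using DERIV_chain2[OF elliptic_fun_deriv DERIV_exp, of w n] that by (simp add: S_def)
  have d1: "deriv (\<lambda>w. elliptic_fun 0 (exp w)) w = elliptic_fun 1 (exp w)" if "w \<in> S" for w
    using DERIV_imp_deriv[OF d[OF that, of 0]] by simp
  have d2: "deriv (deriv (\<lambda>w. elliptic_fun 0 (exp w))) w = elliptic_fun 2 (exp w)" if "w \<in> S" for w
  proof -
    have "(deriv (\<lambda>w. elliptic_fun 0 (exp w)) has_field_derivative elliptic_fun (Suc 1) (exp w)) (at w)"
      by (rule has_field_derivative_transform_within_open[OF d[OF that, of 1] S(1) that]) (simp_all add: d1)
    thus ?thesis
      by (simp add: DERIV_imp_deriv numeral_2_eq_2)
  qed
  have "eventually (\<lambda>w. w \<in> S) (nhds 0)"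
    by (rule eventually_nhds_in_open[OF S])
  hence ev: "eventually (\<lambda>w. deriv (deriv (\<lambda>w. elliptic_fun 0 (exp w))) w = \<beta> * elliptic_fun 0 (exp w) + (1 / 2) * elliptic_fun 0 (exp w) ^ 3) (nhds 0)"
    by eventually_elim (use d2 \<beta> in \<open>simp add: S_def\<close>)
  have "deriv (deriv (\<lambda>w. elliptic_fun 0 (exp w))) has_fps_expansion fps_deriv (fps_deriv elliptic_fps)"
    by (intro has_fps_expansion_deriv has_fps_expansion_elliptic_fun)
  moreover have "(\<lambda>w. \<beta> * elliptic_fun 0 (exp w) + (1 / 2) * elliptic_fun 0 (exp w) ^ 3) has_fps_expansion
      fps_const \<beta> * elliptic_fps + fps_const (1 / 2) * elliptic_fps ^ 3"
    by (intro fps_expansion_intros has_fps_expansion_elliptic_fun)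
  hence "deriv (deriv (\<lambda>w. elliptic_fun 0 (exp w))) has_fps_expansion
      fps_const \<beta> * elliptic_fps + fps_const (1 / 2) * elliptic_fps ^ 3"
    by (subst has_fps_expansion_cong[OF ev refl])
  ultimately show ?thesis
    using fps_expansion_unique_complex by blast
qed

lemma elliptic_fps_0: "elliptic_fps $ 0 = 0"
  by (simp add: elliptic_fps_def fps_tanh_half_0 lambert_symm_def)

lemma elliptic_fps_1: "elliptic_fps $ 1 = theta3_0 (- q) ^ 4 / 2"
  by (simp add: elliptic_fps_def fps_tanh_half_1[simplified] lambert_symm_def theta3_0_power4)

lemma elliptic_fps_odd:
  "fact (2 * k + 1) * elliptic_fps $ (2 * k + 1) / 4 = of_real (bern_c (k + 1)) - lambertU (2 * k + 1) q"
proof -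
  have "fact (2 * k + 1) * elliptic_fps $ (2 * k + 1) =
      fact (2 * k + 1) * fps_tanh_half $ (2 * k + 1) + lambert_symm (2 * k + 1) 1"
    by (simp add: elliptic_fps_def distrib_left del: fact_Suc)
  \<comment> \<open>At \<open>z = 1\<close> and odd index the two halves of
    \<open>lambert_symm\<close> coincide, which doubles the \<open>- 2\<close> of
    \<open>lambertU_eq\<close> and matches the factor 4 at \<open>bern_c\<close>.\<close>
  also have "lambert_symm (2 * k + 1) 1 = - 4 * lambertU (2 * k + 1) q"
    using lambertU_eq[of "2 * k + 1"] by (simp add: lambert_symm_def)
  finally show ?thesis
    unfolding fps_tanh_half_bern_c by simp
qed

end

theorem theorem5p4:
  fixes q :: complex and n :: nat
  assumes "0 < norm q" and "norm q < 1" and "n \<ge> 1"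
  shows "theta3_0 (- q) ^ (4 * n ^ 2) =
    1 + (\<Sum>p = 1..n. (-1) ^ p * 2 ^ (2 * n ^ 2 + n) * (\<Prod>r = 1..2 * n - 1. inverse (fact r)) *
          (\<Sum>S | S \<noteq> {} \<and> S \<subseteq> {1..n} \<and> card S = p. Determinant.det (mat_M n S q)))"
proof -
  interpret nome q
    using assms(1,2) by unfold_locales auto
  define K :: complex where "K = 2 ^ (2 * n\<^sup>2 + n) * (\<Prod>r = 1..2 * n - 1. inverse (fact r))"
  define D where "D = (\<lambda>S. (-1) ^ card S * Determinant.det (mat_M n S q))"
  define A where "A = {S. S \<noteq> {} \<and> S \<subseteq> {1..n}}"
  have fin: "finite A"
    unfolding A_def by (rule finite_subset[of _ "Pow {1..n}"]) auto
  have card: "card S \<in> {1..n}" if "S \<in> A" for S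
    using that card_mono[of "{1..n}" S] finite_subset[of S "{1..n}"] card_gt_0_iff[of S] by (auto simp: A_def)
  have theta: "K * (\<Sum>S\<in>Pow {1..n}. D S) = theta3_0 (- q) ^ (4 * n\<^sup>2)"
  proof -
    obtain \<beta> where "fps_deriv (fps_deriv elliptic_fps) = fps_const \<beta> * elliptic_fps + fps_const (1 / 2) * elliptic_fps ^ 3"
      using elliptic_fps_ode by blast
    from normalized_hankel_det[OF elliptic_fps_0 this elliptic_fps_1, of n] show ?thesis
      unfolding elliptic_fps_odd det_bern_c_diff_lambertU K_def D_def .
  qed
  \<comment> \<open>The case \<open>t = 1\<close>, since tanh (w / 2) has slope 1/2 at 0. It fixes
    the contribution of the empty set, which the sum over \<open>p \<ge> 1\<close> omits.\<close>
  have "K * Determinant.det (mat n n (\<lambda>(a, b). of_real (bern_c (a + b + 1)))) = 1 ^ (4 * n\<^sup>2)"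
    using normalized_hankel_det[OF fps_tanh_half_0 fps_tanh_half_ode, where t = "1 :: complex" and n = n]
    unfolding fps_tanh_half_bern_c K_def by (simp add: fps_tanh_half_1[simplified])
  also have "mat n n (\<lambda>(a, b). complex_of_real (bern_c (a + b + 1))) = mat_M n {} q"
    by (rule eq_matI) (auto simp: mat_M_def)
  finally have empty: "K * D {} = 1"
    by (simp add: D_def)
  have "(\<Sum>p = 1..n. (-1) ^ p * 2 ^ (2 * n ^ 2 + n) * (\<Prod>r = 1..2 * n - 1. inverse (fact r)) *
          (\<Sum>S | S \<noteq> {} \<and> S \<subseteq> {1..n} \<and> card S = p. Determinant.det (mat_M n S q))) =
      (\<Sum>p = 1..n. K * (\<Sum>S | S \<in> A \<and> card S = p. D S))"
    by (simp add: K_def D_def A_def sum_distrib_left mult_ac conj_assoc)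
  also have "\<dots> = K * (\<Sum>S\<in>A. D S)"
    unfolding sum_distrib_left[symmetric]
    by (subst sum.group[OF fin]) (use card in auto)
  also have "\<dots> = K * (\<Sum>S\<in>Pow {1..n}. D S) - K * D {}"
  proof -
    have "Pow {1..n} = insert {} A" "{} \<notin> A"
      by (auto simp: A_def)
    thus ?thesis
      using fin by (simp add: distrib_left)
  qed
  finally show ?thesis
    unfolding theta empty by simp
qed

end
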